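(* Let $R$ be an indecomposable, reduced, crystallographic root system in a finite-dimensional Euclidean vector space $\mathfrak a$, with reflection group $W$, let $k\ge 0$ be a nonnegative multiplicity function on $R$, and let $\mathrm{Exp}_W$ be the associated Dunkl kernel. Then for each $x\in\mathfrak a$ there exists a unique probability measure $\mu_x\in M^1(\mathfrak a)$ such that $$\mathrm{Exp}_W(x,z)=\int_{\mathfrak a}e^{\langle\xi,z\rangle}\,d\mu_x(\xi)\qquad\text{for all } z\in\mathfrak a_{\mathbb C}.$$ The support of $\mu_x$ is contained in $C(x)$.
   Context: Let $\mathfrak a$ be a finite-dimensional Euclidean vector space with inner product $\langle\cdot,\cdot\rangle$ and norm $|\cdot|$; the same notation is used for the complex bilinear extension of $\langle\cdot,\cdot\rangle$ to the complexification $\mathfrak a_{\mathbb C}$. For $\alpha\in\mathfrak a\setminus\{0\}$ put $\alpha^\vee=\frac{2\alpha}{\langle\alpha,\alpha\rangle}$ and $\sigma_\alpha(x)=x-\langle x,\alpha^\vee\rangle\alpha$. Root system: $R\subset\mathfrak a\setminus\{0\}$ is a finite set which spans $\mathfrak a$ and satisfies $\sigma_\alpha(R)=R$ and $\langle\alpha,\beta^\vee\rangle\in\mathbb Z$ for all $\alpha,\beta\in R$ (crystallographic), $R\cap\mathbb R\alpha=\{\pm\alpha\}$ for all $\alpha\in R$ (reduced), and $R$ is indecomposable (not a disjoint union of two nonempty mutually orthogonal subsets). $W$ is the finite reflection group generated by the $\sigma_\alpha$, $\alpha\in R$. Fix a positive subsystem $R_+$ of $R$. A nonnegative multiplicity function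 is a family $k=(k_\alpha)_{\alpha\in R}$ with $k_\alpha\ge 0$ and $k_\alpha=k_\beta$ whenever $\alpha,\beta$ lie in the same $W$-orbit. Dunkl operators and intertwiner: $\mathcal P=\mathbb C[\mathfrak a]$ is the space of complex polynomial functions on $\mathfrak a$ and $\mathcal P_n\subset\mathcal P$ the subspace of polynomials homogeneous of degree $n\in\mathbb Z_+=\{0,1,2,\dots\}$. For $\xi\in\mathfrak a$ the rational Dunkl operator is $$T_\xi=\partial_\xi+\sum_{\alpha\in R_+}k_\alpha\langle\alpha,\xi\rangle\frac{1}{\langle\alpha,\cdot\rangle}(1-\sigma_\alpha),$$ where $\sigma_\alpha$ acts on functions by $(\sigma_\alpha f)(x)=f(\sigma_\alpha x)$. There is a unique linear isomorphism $V=V_k$ of $\mathcal P$ (Dunkl's intertwining operator) with $V(1)=1$, $V(\mathcal P_n)=\mathcal P_n$ for all $n$, and $T_\xi V=V\partial_\xi$ for all $\xi\in\mathfrak a$. For $r>0$ let $K_r=\{x\in\mathfrak a:|x|\le r\}$ and let $A_r$ be the Banach space of functions $f:K_r\to\mathbb C$ of the form $f=\sum_{n\ge0}f_n$ with $f_n\in\mathcal P_n$ and $\|f\|_{A_r}:=\sum_{n\ge0}\sup_{K_r}|f_n|<\infty$; $V$ extends to a continuous linear operator on $A_r$ by $V(\sum_n f_n):=\sum_n Vf_n$. Dunkl kernel: $\mathrm{Exp}_W(\cdot,z):=V(e^{\langle\cdot,z\rangle})$ for $z\in\mathfrak a_{\mathbb C}$. It extends to a holomorphic function on $\mathfrak a_{\mathbb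 C}\times\mathfrak a_{\mathbb C}$, symmetric in its arguments; for $\lambda\in\mathfrak a_{\mathbb C}$, $\mathrm{Exp}_W(\lambda,\cdot)$ is the unique holomorphic solution $f$ of $T_\xi f=\langle\lambda,\xi\rangle f$ for all $\xi\in\mathfrak a$, $f(0)=1$. $C(x)$ denotes the closure of the convex hull of the orbit $Wx$ in $\mathfrak a$, and $M^1(\mathfrak a)$ the set of probability measures on the Borel $\sigma$-algebra of $\mathfrak a$. *)

theory Defs
  imports "HOL-Probability.Probability"
begin

section \<open>Root systems\<close>

definition coroot :: "'a::euclidean_space \<Rightarrow> 'a" where
  "coroot \<alpha> = (2 / (\<alpha> \<bullet> \<alpha>)) *\<^sub>R \<alpha>"

definition root_refl :: "'a::euclidean_space \<Rightarrow> 'a \<Rightarrow> 'a" where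
  "root_refl \<alpha> x = x - (x \<bullet> coroot \<alpha>) *\<^sub>R \<alpha>"

definition root_system :: "'a::euclidean_space set \<Rightarrow> bool" where
  "root_system R \<longleftrightarrow> finite R \<and> 0 \<notin> R \<and> span R = UNIV \<and> (\<forall>\<alpha>\<in>R. root_refl \<alpha> ` R = R)"

definition crystallographic :: "'a::euclidean_space set \<Rightarrow> bool" where
  "crystallographic R \<longleftrightarrow> (\<forall>\<alpha>\<in>R. \<forall>\<beta>\<in>R. \<alpha> \<bullet> coroot \<beta> \<in> \<int>)"

definition reduced_roots :: "'a::euclidean_space set \<Rightarrow> bool" where
  "reduced_roots R \<longleftrightarrow> (\<forall>\<alpha>\<in>R. R \<inter> span {\<alpha>} = {\<alpha>, - \<alpha>})"

definition indecomposable :: "'a::euclidean_space set \<Rightarrow> bool" where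
  "indecomposable R \<longleftrightarrow>
     \<not> (\<exists>A B. A \<noteq> {} \<and> B \<noteq> {} \<and> A \<inter> B = {} \<and> A \<union> B = R \<and> (\<forall>\<alpha>\<in>A. \<forall>\<beta>\<in>B. \<alpha> \<bullet> \<beta> = 0))"

definition positive_subsystem :: "'a::euclidean_space set \<Rightarrow> 'a set \<Rightarrow> bool" where
  "positive_subsystem R Rp \<longleftrightarrow>
     (\<exists>v. (\<forall>\<alpha>\<in>R. \<alpha> \<bullet> v \<noteq> 0) \<and> Rp = {\<alpha>\<in>R. \<alpha> \<bullet> v > 0})"

text \<open>Reflections are involutions, so the monoid they generate under composition is already
  the group they generate.\<close>

inductive_set refl_group :: "'a::euclidean_space set \<Rightarrow> ('a \<Rightarrow> 'a) set" for R where
  refl_group_id: "id \<in> refl_group R"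
| refl_group_comp: "w \<in> refl_group R \<Longrightarrow> \<alpha> \<in> R \<Longrightarrow> root_refl \<alpha> \<circ> w \<in> refl_group R"

definition nonneg_multiplicity :: "'a::euclidean_space set \<Rightarrow> ('a \<Rightarrow> real) \<Rightarrow> bool" where
  "nonneg_multiplicity R k \<longleftrightarrow>
     (\<forall>\<alpha>\<in>R. k \<alpha> \<ge> 0) \<and> (\<forall>\<alpha>\<in>R. \<forall>w\<in>refl_group R. k (w \<alpha>) = k \<alpha>)"


section \<open>Dunkl operators\<close>

definition polys :: "('a::euclidean_space \<Rightarrow> complex) set" where
  "polys = {f. polynomial_function f}"

definition hom_polys :: "nat \<Rightarrow> ('a::euclidean_space \<Rightarrow> complex) set" where
  "hom_polys n = {f \<in> polys. \<forall>c x. f (c *\<^sub>R x) = of_real (c ^ n) * f x}"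

definition dir_deriv :: "'a::euclidean_space \<Rightarrow> ('a \<Rightarrow> complex) \<Rightarrow> 'a \<Rightarrow> complex" where
  "dir_deriv \<xi> f = (\<lambda>x. frechet_derivative f (at x) \<xi>)"

text \<open>The polynomial \<open>(f - f \<circ> \<sigma>\<^sub>\<alpha>) / \<langle>\<alpha>, \<cdot>\<rangle>\<close>. A pointwise quotient would
  have the wrong value (zero) on the hyperplane orthogonal to \<open>\<alpha>\<close>; for polynomial \<open>f\<close>
  and \<open>\<alpha> \<noteq> 0\<close> the polynomial described here exists and is unique.\<close>

definition refl_quotient :: "'a::euclidean_space \<Rightarrow> ('a \<Rightarrow> complex) \<Rightarrow> 'a \<Rightarrow> complex" where
  "refl_quotient \<alpha> f =
     (THE g. g \<in> polys \<and> (\<forall>x. of_real (\<alpha> \<bullet> x) * g x = f x - f (root_refl \<alpha> x)))"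

definition dunkl_op ::
  "'a::euclidean_space set \<Rightarrow> ('a \<Rightarrow> real) \<Rightarrow> 'a \<Rightarrow> ('a \<Rightarrow> complex) \<Rightarrow> 'a \<Rightarrow> complex" where
  "dunkl_op Rp k \<xi> f =
     (\<lambda>x. dir_deriv \<xi> f x + (\<Sum>\<alpha>\<in>Rp. of_real (k \<alpha> * (\<alpha> \<bullet> \<xi>)) * refl_quotient \<alpha> f x))"


section \<open>The intertwining operator and the Dunkl kernel\<close>

definition is_intertwiner ::
  "'a::euclidean_space set \<Rightarrow> ('a \<Rightarrow> real) \<Rightarrow> (('a \<Rightarrow> complex) \<Rightarrow> 'a \<Rightarrow> complex) \<Rightarrow> bool" where
  "is_intertwiner Rp k V \<longleftrightarrow>
     bij_betw V polys polys \<and>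
     (\<forall>f\<in>polys. \<forall>g\<in>polys. V (\<lambda>x. f x + g x) = (\<lambda>x. V f x + V g x)) \<and>
     (\<forall>c. \<forall>f\<in>polys. V (\<lambda>x. c * f x) = (\<lambda>x. c * V f x)) \<and>
     V (\<lambda>x. 1) = (\<lambda>x. 1) \<and>
     (\<forall>n. V ` hom_polys n = hom_polys n) \<and>
     (\<forall>\<xi>. \<forall>f\<in>polys. dunkl_op Rp k \<xi> (V f) = V (dir_deriv \<xi> f))"

text \<open>\<open>V\<close> only matters on \<^const>\<open>polys\<close>; \<^const>\<open>extensional\<close> fixes its values elsewhere so
  that the description is definite.\<close>

definition intertwiner ::
  "'a::euclidean_space set \<Rightarrow> ('a \<Rightarrow> real) \<Rightarrow> ('a \<Rightarrow> complex) \<Rightarrow> 'a \<Rightarrow> complex" where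
  "intertwiner Rp k = (THE V. V \<in> extensional polys \<and> is_intertwiner Rp k V)"

text \<open>\<open>f\<close>, restricted to the ball \<open>K\<^sub>r\<close>, belongs to the Banach space \<open>A\<^sub>r\<close> with homogeneous
  components \<open>F n\<close>; for \<open>r > 0\<close> these are uniquely determined.\<close>

definition A_expansion ::
  "real \<Rightarrow> ('a::euclidean_space \<Rightarrow> complex) \<Rightarrow> (nat \<Rightarrow> 'a \<Rightarrow> complex) \<Rightarrow> bool" where
  "A_expansion r f F \<longleftrightarrow>
     (\<forall>n. F n \<in> hom_polys n) \<and>
     summable (\<lambda>n. SUP x\<in>cball 0 r. norm (F n x)) \<and>
     (\<forall>x\<in>cball 0 r. (\<lambda>n. F n x) sums f x)"

definition intertwiner_A ::
  "'a::euclidean_space set \<Rightarrow> ('a \<Rightarrow> real) \<Rightarrow> real \<Rightarrow> ('a \<Rightarrow> complex) \<Rightarrow> 'a \<Rightarrow> complex" where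
  "intertwiner_A Rp k r f = (\<lambda>x. \<Sum>n. intertwiner Rp k ((THE F. A_expansion r f F) n) x)"

text \<open>The complexification of \<open>'a\<close> is \<open>'a \<times> 'a\<close>, where \<open>(u, v)\<close> stands for \<open>u + \<i> v\<close>;
  only the pairing of a real with a complexified vector is needed.\<close>

definition cpair :: "'a::euclidean_space \<Rightarrow> 'a \<times> 'a \<Rightarrow> complex" where
  "cpair \<xi> z = Complex (\<xi> \<bullet> fst z) (\<xi> \<bullet> snd z)"

text \<open>The exponential lies in \<open>A\<^sub>r\<close> for every \<open>r > 0\<close> with the same homogeneous components, so
  any positive \<open>r \<ge> |x|\<close> gives the same value.\<close>

definition dunkl_kernel ::
  "'a::euclidean_space set \<Rightarrow> ('a \<Rightarrow> real) \<Rightarrow> 'a \<Rightarrow> 'a \<times> 'a \<Rightarrow> complex" where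
  "dunkl_kernel Rp k x z = intertwiner_A Rp k (norm x + 1) (\<lambda>y. exp (cpair y z)) x"


section \<open>Representing measures\<close>

definition orbit_hull :: "'a::euclidean_space set \<Rightarrow> 'a \<Rightarrow> 'a set" where
  "orbit_hull R x = closure (convex hull ((\<lambda>w. w x) ` refl_group R))"

definition borel_probs :: "'a::euclidean_space measure set" where
  "borel_probs = {\<mu>. prob_space \<mu> \<and> sets \<mu> = sets borel}"

definition measure_support :: "'a::euclidean_space measure \<Rightarrow> 'a set" where
  "measure_support \<mu> = {x. \<forall>U. open U \<longrightarrow> x \<in> U \<longrightarrow> emeasure \<mu> U > 0}"

definition represents_kernel ::
  "'a::euclidean_space set \<Rightarrow> ('a \<Rightarrow> real) \<Rightarrow> 'a \<Rightarrow> 'a measure \<Rightarrow> bool" where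
  "represents_kernel Rp k x \<mu> \<longleftrightarrow>
     (\<forall>z. integrable \<mu> (\<lambda>\<xi>. exp (cpair \<xi> z)) \<and>
          dunkl_kernel Rp k x z = (\<integral>\<xi>. exp (cpair \<xi> z) \<partial>\<mu>))"

end

theory Submission
  imports Defs
begin

text \<open>Applying \<open>\<Sum>i. x\<^sub>i T\<^sub>i\<close> to \<open>V f\<close> for \<open>f\<close> homogeneous of degree \<open>n\<close> gives the radial equation
  \<open>n V f + (\<Sum>\<alpha>\<in>Rp. k \<alpha> (V f - V f \<circ> \<sigma>\<^sub>\<alpha>)) = (\<Sum>i. x\<^sub>i V (\<partial>\<^sub>i f))\<close>, which determines \<open>V\<close> by a maximum
  principle. For \<open>k \<ge> 0\<close> it is a Feynman-Kac equation: \<open>V f x\<close> is the expectation of \<open>f (\<xi> x)\<close> for the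
  random vector \<open>\<xi> x = \<integral>\<^sub>0\<^sup>1 W\<^sub>t x dt\<close>, where \<open>W\<close> is the jump process on the reflection group that jumps by
  \<open>\<sigma>\<^sub>\<alpha>\<close> at rate \<open>k \<alpha> / t\<close> as \<open>t\<close> decreases from \<open>1\<close> to \<open>0\<close>. Conditioning on the first jump time \<open>s\<close> yields
  the self-similarity \<open>\<xi> x = (1 - s) x + s \<xi>' (\<sigma>\<^sub>\<alpha> x)\<close>, from which \<open>\<xi>\<close> is constructed as a random series.
  The operator so defined intertwines because the defect \<open>T\<^sub>\<eta> (V f) - V (\<partial>\<^sub>\<eta> f)\<close> satisfies an equation to which
  the maximum principle applies, so the law of \<open>\<xi> x\<close> represents the Dunkl kernel, and it lives on the hull of
  the orbit. Any representing measure has the same exponential moments; these bound its support by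
  an exponential Chebyshev inequality and determine it by the Stone-Weierstrass theorem.\<close>

section \<open>Polynomial functions\<close>

text \<open>\<open>polynomial_function\<close> quantifies over all bounded linear functionals of the
  value; on the complex numbers these are real combinations of \<open>Re\<close> and
  \<open>Im\<close>.\<close>

lemma polys_iff_Re_Im:
  "f \<in> polys \<longleftrightarrow> real_polynomial_function (\<lambda>x. Re (f x)) \<and> real_polynomial_function (\<lambda>x. Im (f x))"
  (is "?l \<longleftrightarrow> ?r")
proof
  assume ?l
  then show ?r
    using bounded_linear_Re bounded_linear_Im by (auto simp: polys_def polynomial_function_def o_def)
next
  assume r: ?r
  have "real_polynomial_function (g \<circ> f)" if "bounded_linear g" for g :: "complex \<Rightarrow> real"
  proof -
    interpret g: bounded_linear g by fact
    have "g (f x) = Re (f x) * g 1 + Im (f x) * g \<i>" for x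
    proof -
      have "f x = Re (f x) *\<^sub>R 1 + Im (f x) *\<^sub>R \<i>"
        by (simp add: complex_eq_iff)
      then show ?thesis
        by (metis g.add g.scale real_scaleR_def)
    qed
    then have "g \<circ> f = (\<lambda>x. Re (f x) * g 1 + Im (f x) * g \<i>)" by auto
    with r show ?thesis
      by (auto intro!: real_polynomial_function.intros(2-4))
  qed
  then show ?l by (simp add: polys_def polynomial_function_def)
qed

lemma polys_const [simp, intro]: "(\<lambda>x. c) \<in> polys"
  by (simp add: polys_iff_Re_Im real_polynomial_function.intros(2))

lemma polys_inner [simp, intro]: "(\<lambda>x. of_real (x \<bullet> v)) \<in> polys"
  by (simp add: polys_iff_Re_Im real_polynomial_function.intros bounded_linear_inner_left)

lemma polys_add [simp, intro]: "f \<in> polys \<Longrightarrow> g \<in> polys \<Longrightarrow> (\<lambda>x. f x + g x) \<in> polys"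
  by (simp add: polys_iff_Re_Im real_polynomial_function.intros)

lemma polys_mult [simp, intro]: "f \<in> polys \<Longrightarrow> g \<in> polys \<Longrightarrow> (\<lambda>x. f x * g x) \<in> polys"
  by (simp add: polys_iff_Re_Im real_polynomial_function.intros real_polynomial_function_diff)

lemma polys_diff [simp, intro]: "f \<in> polys \<Longrightarrow> g \<in> polys \<Longrightarrow> (\<lambda>x. f x - g x) \<in> polys"
  by (simp add: polys_iff_Re_Im real_polynomial_function_diff)

lemma polys_sum [intro]: "(\<And>i. i \<in> I \<Longrightarrow> f i \<in> polys) \<Longrightarrow> (\<lambda>x. \<Sum>i\<in>I. f i x) \<in> polys"
  by (induction I rule: infinite_finite_induct) auto

lemma polys_power [intro]: "f \<in> polys \<Longrightarrow> (\<lambda>x. f x ^ n) \<in> polys"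
  by (induction n) auto

lemma polys_compose_linear:
  assumes "f \<in> polys" "bounded_linear h"
  shows "(\<lambda>x. f (h x)) \<in> polys"
  using polynomial_function_compose[OF polynomial_function_bounded_linear[OF assms(2)], of f] assms(1)
  by (simp add: polys_def o_def)

lemma polys_continuous: "f \<in> polys \<Longrightarrow> continuous_on S f"
  by (simp add: polys_def continuous_on_polymonial_function)

text \<open>The induction for real polynomial functions is transferred to complex values by writing
  f as \<open>Re f + \<i> * Im f\<close>, and its linear case is narrowed to inner products with a
  fixed vector.\<close>

lemma polys_induct [consumes 1, case_names const inner add mult]:
  assumes f: "f \<in> polys"
    and c: "\<And>c. P (\<lambda>x. c)"
    and i: "\<And>v. P (\<lambda>x. of_real (x \<bullet> v))"
    and a: "\<And>f g. f \<in> polys \<Longrightarrow> g \<in> polys \<Longrightarrow> P f \<Longrightarrow> P g \<Longrightarrow> P (\<lambda>x. f x + g x)"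
    and m: "\<And>f g. f \<in> polys \<Longrightarrow> g \<in> polys \<Longrightarrow> P f \<Longrightarrow> P g \<Longrightarrow> P (\<lambda>x. f x * g x)"
  shows "P f"
proof -
  have *: "(\<lambda>x. of_real (r x)) \<in> polys \<and> P (\<lambda>x. complex_of_real (r x))"
    if "real_polynomial_function r" for r :: "'a \<Rightarrow> real"
    using that
  proof induction
    case (linear r)
    \<comment> \<open>\<open>adjoint r 1\<close> is the Riesz representative of the functional
      r.\<close>
    then have "r x = x \<bullet> adjoint r 1" for x
      using adjoint_works[of r x 1] by (simp add: bounded_linear.linear)
    then have "r = (\<lambda>x. x \<bullet> adjoint r 1)" by auto
    then show ?case using i polys_inner by metis
  next
    case (const d)
    show ?case using c by simp
  next
    case (add r q)
    then show ?case using a by auto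
  next
    case (mult r q)
    then show ?case using m by auto
  qed
  have "f = (\<lambda>x. of_real (Re (f x)) + \<i> * of_real (Im (f x)))"
    by (auto simp: complex_eq_iff)
  moreover have "P (\<lambda>x. of_real (Re (f x)) + \<i> * of_real (Im (f x)))"
    using * f by (intro a m c polys_mult polys_const) (auto simp: polys_iff_Re_Im)
  ultimately show ?thesis by simp
qed

subsection \<open>Directional derivatives\<close>

text \<open>\<open>dir_deriv\<close> rests on the choice in \<open>frechet_derivative\<close>, so
  the induction carries an explicit derivative D together with the polynomiality of its directional
  values.\<close>

lemma polys_has_derivative_ex:
  "f \<in> polys \<Longrightarrow> \<exists>D. (\<forall>x. (f has_derivative D x) (at x)) \<and> (\<forall>\<xi>. (\<lambda>x. D x \<xi>) \<in> polys)"
proof (induction rule: polys_induct)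
  case (const c)
  show ?case by (rule exI[of _ "\<lambda>x h. 0"]) auto
next
  case (inner v)
  show ?case by (rule exI[of _ "\<lambda>x h. of_real (h \<bullet> v)"]) (auto intro!: derivative_eq_intros)
next
  case (add f g)
  then obtain D E where "\<forall>x. (f has_derivative D x) (at x)" "\<forall>\<xi>. (\<lambda>x. D x \<xi>) \<in> polys"
    "\<forall>x. (g has_derivative E x) (at x)" "\<forall>\<xi>. (\<lambda>x. E x \<xi>) \<in> polys" by blast
  then show ?case
    by (intro exI[of _ "\<lambda>x h. D x h + E x h"]) (auto intro!: derivative_eq_intros)
next
  case (mult f g)
  then obtain D E where "\<forall>x. (f has_derivative D x) (at x)" "\<forall>\<xi>. (\<lambda>x. D x \<xi>) \<in> polys"
    "\<forall>x. (g has_derivative E x) (at x)" "\<forall>\<xi>. (\<lambda>x. E x \<xi>) \<in> polys" by blast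
  with mult show ?case
    by (intro exI[of _ "\<lambda>x h. f x * E x h + D x h * g x"]) (auto intro!: derivative_eq_intros)
qed

lemma dir_deriv_unique: "(f has_derivative D) (at x) \<Longrightarrow> dir_deriv \<xi> f x = D \<xi>"
  unfolding dir_deriv_def by (metis frechet_derivative_at)

lemma polys_has_derivative:
  assumes "f \<in> polys"
  shows "(f has_derivative (\<lambda>\<xi>. dir_deriv \<xi> f x)) (at x)"
proof -
  obtain D where D: "\<And>x. (f has_derivative D x) (at x)"
    using polys_has_derivative_ex[OF assms] by blast
  have "(\<lambda>\<xi>. dir_deriv \<xi> f x) = D x"
    by (rule ext, rule dir_deriv_unique, rule D)
  with D show ?thesis by simp
qed

lemma dir_deriv_polys [simp, intro]:
  assumes "f \<in> polys"
  shows "dir_deriv \<xi> f \<in> polys"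
proof -
  obtain D where D: "\<And>x. (f has_derivative D x) (at x)" "\<And>\<xi>. (\<lambda>x. D x \<xi>) \<in> polys"
    using polys_has_derivative_ex[OF assms] by blast
  have "dir_deriv \<xi> f = (\<lambda>x. D x \<xi>)"
    by (rule ext, rule dir_deriv_unique, rule D)
  with D show ?thesis by simp
qed

lemma dir_deriv_const [simp]: "dir_deriv \<xi> (\<lambda>x. c) = (\<lambda>x. 0)"
  by (rule ext, rule dir_deriv_unique) auto

lemma dir_deriv_inner [simp]: "dir_deriv \<xi> (\<lambda>x. of_real (x \<bullet> v)) = (\<lambda>x. of_real (\<xi> \<bullet> v))"
  by (rule ext, rule dir_deriv_unique) (auto intro!: derivative_eq_intros)

lemma dir_deriv_add [simp]:
  assumes "f \<in> polys" "g \<in> polys"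
  shows "dir_deriv \<xi> (\<lambda>x. f x + g x) = (\<lambda>x. dir_deriv \<xi> f x + dir_deriv \<xi> g x)"
  by (rule ext, rule dir_deriv_unique) (auto intro!: derivative_eq_intros polys_has_derivative assms)

lemma dir_deriv_mult [simp]:
  assumes "f \<in> polys" "g \<in> polys"
  shows "dir_deriv \<xi> (\<lambda>x. f x * g x) = (\<lambda>x. f x * dir_deriv \<xi> g x + dir_deriv \<xi> f x * g x)"
  by (rule ext, rule dir_deriv_unique) (auto intro!: derivative_eq_intros polys_has_derivative assms)

lemma dir_deriv_cmult:
  "f \<in> polys \<Longrightarrow> dir_deriv \<xi> (\<lambda>x. c * f x) = (\<lambda>x. c * dir_deriv \<xi> f x)"
  by simp

lemma dir_deriv_sum:
  assumes "\<And>i. i \<in> I \<Longrightarrow> f i \<in> polys"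
  shows "dir_deriv \<xi> (\<lambda>x. \<Sum>i\<in>I. f i x) = (\<lambda>x. \<Sum>i\<in>I. dir_deriv \<xi> (f i) x)"
  by (rule ext, rule dir_deriv_unique) (auto intro!: derivative_eq_intros polys_has_derivative assms)

lemma dir_deriv_linear:
  assumes "f \<in> polys"
  shows "linear (\<lambda>\<xi>. dir_deriv \<xi> f x)"
  using has_derivative_bounded_linear[OF polys_has_derivative[OF assms]] by (rule bounded_linear.linear)

lemma dir_deriv_compose_linear:
  assumes "f \<in> polys" "bounded_linear h"
  shows "dir_deriv \<xi> (\<lambda>x. f (h x)) x = dir_deriv (h \<xi>) f (h x)"
  by (rule dir_deriv_unique, rule has_derivative_compose[OF _ polys_has_derivative[OF assms(1)]])
     (rule bounded_linear_imp_has_derivative[OF assms(2)])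

lemma dir_deriv_commute:
  "f \<in> polys \<Longrightarrow> dir_deriv \<xi> (dir_deriv \<eta> f) = dir_deriv \<eta> (dir_deriv \<xi> f)"
  by (induction rule: polys_induct) (simp_all add: algebra_simps)

lemma linear_expand_Basis:
  fixes L :: "'a::euclidean_space \<Rightarrow> complex"
  assumes "linear L"
  shows "L \<xi> = (\<Sum>b\<in>Basis. of_real (\<xi> \<bullet> b) * L b)"
proof -
  have "L \<xi> = L (\<Sum>b\<in>Basis. (\<xi> \<bullet> b) *\<^sub>R b)" by (simp add: euclidean_representation)
  also have "\<dots> = (\<Sum>b\<in>Basis. of_real (\<xi> \<bullet> b) * L b)"
    unfolding linear_sum[OF assms] linear_scale[OF assms] by (simp add: scaleR_conv_of_real)
  finally show ?thesis .
qed

text \<open>Off the hyperplane orthogonal to \<alpha> one can divide; a point x of the hyperplane is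
  a limit of the points \<open>x + \<alpha> / (n + 1)\<close>, which lie off it.\<close>

lemma eq_zero_if_inner_mult_zero:
  fixes h :: "'a::euclidean_space \<Rightarrow> complex"
  assumes h: "continuous_on UNIV h" and "\<alpha> \<noteq> 0" and 0: "\<And>x. of_real (\<alpha> \<bullet> x) * h x = 0"
  shows "h x = 0"
proof (cases "\<alpha> \<bullet> x = 0")
  case False
  with 0[of x] show ?thesis by simp
next
  case True
  let ?X = "\<lambda>n. x + (1 / real (Suc n)) *\<^sub>R \<alpha>"
  have "(\<lambda>n. 1 / real (Suc n)) \<longlonglongrightarrow> 0"
    using LIMSEQ_inverse_real_of_nat by (simp add: inverse_eq_divide)
  then have "?X \<longlonglongrightarrow> x + 0 *\<^sub>R \<alpha>"
    by (intro tendsto_intros)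
  then have "(\<lambda>n. h (?X n)) \<longlonglongrightarrow> h x"
    using h by (auto intro: continuous_on_tendsto_compose)
  moreover have "h (?X n) = 0" for n
    using 0[of "?X n"] True \<open>\<alpha> \<noteq> 0\<close> by (auto simp: inner_add_right simp del: of_nat_Suc)
  ultimately show ?thesis
    by (simp add: LIMSEQ_const_iff)
qed

subsection \<open>Homogeneous polynomials\<close>

lemma hom_polysD: "f \<in> hom_polys n \<Longrightarrow> f \<in> polys"
  "f \<in> hom_polys n \<Longrightarrow> f (c *\<^sub>R x) = of_real (c ^ n) * f x"
  by (auto simp: hom_polys_def)

lemma hom_polys_add: "f \<in> hom_polys n \<Longrightarrow> g \<in> hom_polys n \<Longrightarrow> (\<lambda>x. f x + g x) \<in> hom_polys n"
  by (auto simp: hom_polys_def algebra_simps)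

lemma hom_polys_diff: "f \<in> hom_polys n \<Longrightarrow> g \<in> hom_polys n \<Longrightarrow> (\<lambda>x. f x - g x) \<in> hom_polys n"
  by (auto simp: hom_polys_def algebra_simps)

lemma hom_polys_cmult: "f \<in> hom_polys n \<Longrightarrow> (\<lambda>x. c * f x) \<in> hom_polys n"
  by (auto simp: hom_polys_def algebra_simps)

lemma hom_polys_zero: "(\<lambda>x. 0) \<in> hom_polys n"
  by (auto simp: hom_polys_def)

lemma hom_polys_sum: "(\<And>i. i \<in> I \<Longrightarrow> f i \<in> hom_polys n) \<Longrightarrow> (\<lambda>x. \<Sum>i\<in>I. f i x) \<in> hom_polys n"
  by (induction I rule: infinite_finite_induct) (auto intro: hom_polys_add hom_polys_zero)

lemma hom_polys_mult: "f \<in> hom_polys n \<Longrightarrow> g \<in> hom_polys m \<Longrightarrow> (\<lambda>x. f x * g x) \<in> hom_polys (n + m)"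
  by (auto simp: hom_polys_def power_add)

lemma hom_polys_inner: "(\<lambda>x. of_real (x \<bullet> v)) \<in> hom_polys 1"
  by (auto simp: hom_polys_def)

lemma hom_polys_power: "f \<in> hom_polys 1 \<Longrightarrow> (\<lambda>x. f x ^ n) \<in> hom_polys n"
  by (auto simp: hom_polys_def polys_power power_mult_distrib)

lemma hom_polys_0: "f \<in> hom_polys 0 \<longleftrightarrow> (\<exists>c. f = (\<lambda>x. c))"
proof
  assume "f \<in> hom_polys 0"
  then have "f x = f 0" for x
    using hom_polysD(2)[of f 0 0 x] by simp
  then show "\<exists>c. f = (\<lambda>x. c)" by auto
qed (auto simp: hom_polys_def)

text \<open>A property that is additive but not multiplicative cannot be proved by
  \<open>polys_induct\<close>; decomposing into homogeneous components replaces the product case by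
  the homogeneous one.\<close>

lemma polys_hom_induct [consumes 1, case_names hom add]:
  assumes f: "f \<in> polys"
    and h: "\<And>n f. f \<in> hom_polys n \<Longrightarrow> P f"
    and a: "\<And>f g. f \<in> polys \<Longrightarrow> g \<in> polys \<Longrightarrow> P f \<Longrightarrow> P g \<Longrightarrow> P (\<lambda>x. f x + g x)"
  shows "P f"
proof -
  \<comment> \<open>F says that f is a finite sum of homogeneous components. Unlike P it is stable
    under products, so \<open>polys_induct\<close> applies to it.\<close>
  define F :: "('a \<Rightarrow> complex) \<Rightarrow> bool" where "F = (\<lambda>f. \<exists>N G. (\<forall>n. G n \<in> hom_polys n) \<and> f = (\<lambda>x. \<Sum>n<(N::nat). G n x))"
  have F_add: "F (\<lambda>x. f x + g x)" if "F f" "F g" for f g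
  proof -
    from that obtain N G M H where *: "\<forall>n. G n \<in> hom_polys n" "f = (\<lambda>x. \<Sum>n<(N::nat). G n x)"
      "\<forall>n. H n \<in> hom_polys n" "g = (\<lambda>x. \<Sum>n<(M::nat). H n x)" unfolding F_def by blast
    define GH where "GH n x = (if n < N then G n x else 0) + (if n < M then H n x else 0)" for n x
    have "(\<Sum>n<max N M. if n < N then G n x else 0) = (\<Sum>n<N. G n x)" for x
      by (intro sum.mono_neutral_cong_right) auto
    moreover have "(\<Sum>n<max N M. if n < M then H n x else 0) = (\<Sum>n<M. H n x)" for x
      by (intro sum.mono_neutral_cong_right) auto
    ultimately have "(\<lambda>x. f x + g x) = (\<lambda>x. \<Sum>n<max N M. GH n x)"
      by (simp add: GH_def sum.distrib *)
    moreover have "GH n \<in> hom_polys n" for n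
    proof -
      have "(\<lambda>x. (if n < N then G n else (\<lambda>x. 0)) x + (if n < M then H n else (\<lambda>x. 0)) x) \<in> hom_polys n"
        by (rule hom_polys_add) (use * hom_polys_zero in auto)
      moreover have "GH n = (\<lambda>x. (if n < N then G n else (\<lambda>x. 0)) x + (if n < M then H n else (\<lambda>x. 0)) x)"
        by (auto simp: GH_def)
      ultimately show ?thesis by simp
    qed
    ultimately show ?thesis unfolding F_def by blast
  qed
  have F_hom: "F f" if "f \<in> hom_polys n" for f n
    unfolding F_def
  proof (intro exI conjI)
    show "\<forall>m. (if m = n then f else (\<lambda>x. 0)) \<in> hom_polys m" using that hom_polys_zero by auto
    have "(\<Sum>m<Suc n. (if m = n then f else (\<lambda>x. 0)) x) = f x" for x
      by (simp add: if_distrib[of "\<lambda>f. f x"] cong: if_cong)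
    then show "f = (\<lambda>x. \<Sum>m<Suc n. (if m = n then f else (\<lambda>x. 0)) x)" by auto
  qed
  have F_sum: "F (\<lambda>x. \<Sum>i\<in>I. f i x)" if "\<And>i. i \<in> I \<Longrightarrow> F (f i)" for I :: "nat set" and f
    using that by (induction I rule: infinite_finite_induct) (auto intro: F_add F_hom[OF hom_polys_zero])
  have "F f" using f
  proof (induction rule: polys_induct)
    case (const c)
    then show ?case using F_hom[of _ 0] by (auto simp: hom_polys_0)
  next
    case (inner v)
    then show ?case using F_hom hom_polys_inner by blast
  next
    case (add f g)
    then show ?case using F_add by blast
  next
    case (mult f g)
    then obtain N G M H where *: "\<forall>n. G n \<in> hom_polys n" "f = (\<lambda>x. \<Sum>n<(N::nat). G n x)"
      "\<forall>n. H n \<in> hom_polys n" "g = (\<lambda>x. \<Sum>n<(M::nat). H n x)" unfolding F_def by blast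
    have "(\<lambda>x. f x * g x) = (\<lambda>x. \<Sum>n<N. \<Sum>m<M. G n x * H m x)"
      by (simp add: * sum_product)
    moreover have "F (\<lambda>x. \<Sum>n<N. \<Sum>m<M. G n x * H m x)"
      using * by (intro F_sum) (auto intro: F_hom hom_polys_mult)
    ultimately show ?case by simp
  qed
  then obtain N G where *: "\<forall>n. G n \<in> hom_polys n" "f = (\<lambda>x. \<Sum>n<(N::nat). G n x)"
    unfolding F_def by blast
  have G: "G n \<in> polys" "P (G n)" for n
    using * h hom_polysD(1) by blast+
  have "(\<lambda>x. \<Sum>n<N. G n x) \<in> polys \<and> P (\<lambda>x. \<Sum>n<N. G n x)"
    by (induction N) (auto intro: h[OF hom_polys_zero] a G)
  with * show ?thesis by simp
qed

text \<open>A factor c is cancelled from the scaling law. At \<open>c = 0\<close> this is a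
  continuity argument in c, obtained from \<open>eq_zero_if_inner_mult_zero\<close> on the real
  line. It serves operations that lower the degree by one.\<close>

lemma hom_polysI_mult:
  assumes g: "g \<in> polys" and eq: "\<And>c x. of_real c * g (c *\<^sub>R x) = of_real (c ^ Suc m) * g x"
  shows "g \<in> hom_polys m"
proof -
  have "continuous_on UNIV (\<lambda>c::real. g (c *\<^sub>R x) - of_real (c ^ m) * g x)" for x
    by (intro continuous_on_diff continuous_on_mult continuous_on_of_real continuous_on_power
        continuous_on_const continuous_on_id continuous_on_scaleR
        continuous_on_compose2[OF polys_continuous[OF g, of UNIV]]) simp
  moreover have "of_real (1 \<bullet> c) * (g (c *\<^sub>R x) - of_real (c ^ m) * g x) = 0" for c :: real and x
    using eq[of c x] by (simp add: algebra_simps)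
  ultimately have "g (c *\<^sub>R x) - of_real (c ^ m) * g x = 0" for c :: real and x
    using eq_zero_if_inner_mult_zero[of "\<lambda>c::real. g (c *\<^sub>R x) - of_real (c ^ m) * g x" 1 c] by simp
  with g show ?thesis by (simp add: hom_polys_def)
qed

text \<open>For \<open>n = 0\<close> truncated subtraction leaves degree 0, and the derivative of a
  constant is the zero function. Otherwise differentiate \<open>f (c x) = c ^ n * f x\<close> in x
  and cancel c.\<close>

lemma hom_polys_dir_deriv:
  assumes f: "f \<in> hom_polys n"
  shows "dir_deriv \<xi> f \<in> hom_polys (n - 1)"
proof (cases n)
  case 0
  with f show ?thesis by (auto simp: hom_polys_0)
next
  case (Suc m)
  note fp = hom_polysD(1)[OF f]
  have "of_real c * dir_deriv \<xi> f (c *\<^sub>R x) = of_real (c ^ Suc m) * dir_deriv \<xi> f x" for c x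
  proof -
    have "dir_deriv \<xi> (\<lambda>x. f (c *\<^sub>R x)) x = dir_deriv \<xi> (\<lambda>x. of_real (c ^ n) * f x) x"
      using hom_polysD(2)[OF f] by simp
    moreover have "dir_deriv \<xi> (\<lambda>x. f (c *\<^sub>R x)) x = dir_deriv (c *\<^sub>R \<xi>) f (c *\<^sub>R x)"
      by (intro dir_deriv_compose_linear fp bounded_linear_scaleR_right)
    moreover have "dir_deriv (c *\<^sub>R \<xi>) f (c *\<^sub>R x) = of_real c * dir_deriv \<xi> f (c *\<^sub>R x)"
      using linear_scale[OF dir_deriv_linear[OF fp]] by (simp add: scaleR_conv_of_real)
    ultimately show ?thesis
      using fp by (simp add: dir_deriv_cmult Suc)
  qed
  then show ?thesis using hom_polysI_mult[OF dir_deriv_polys[OF fp]] Suc by simp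
qed

text \<open>Both sides are the derivative of \<open>f (t x) = t ^ n * f x\<close> in t at
  \<open>t = 1\<close>.\<close>

lemma euler_identity:
  assumes f: "f \<in> hom_polys n"
  shows "dir_deriv x f x = of_nat n * f x"
proof -
  have "((\<lambda>t::real. f (t *\<^sub>R x)) has_derivative (\<lambda>h. dir_deriv (h *\<^sub>R x) f (1 *\<^sub>R x))) (at 1)"
    by (rule has_derivative_compose[OF _ polys_has_derivative[OF hom_polysD(1)[OF f]]])
       (auto intro!: derivative_eq_intros)
  moreover have "((\<lambda>t::real. of_real (t ^ n) * f x) has_derivative (\<lambda>h. of_nat n * of_real h * f x)) (at 1)"
    by (auto intro!: derivative_eq_intros)
  ultimately have "(\<lambda>h. dir_deriv (h *\<^sub>R x) f (1 *\<^sub>R x)) = (\<lambda>h. of_nat n * of_real h * f x)"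
    using hom_polysD(2)[OF f] by (simp add: has_derivative_unique)
  from fun_cong[OF this, of 1] show ?thesis by simp
qed

lemma const_if_dir_deriv_zero:
  assumes "f \<in> polys" and "\<And>\<xi>. dir_deriv \<xi> f = (\<lambda>x. 0)"
  shows "f = (\<lambda>x. f 0)"
proof -
  have "(f has_derivative (\<lambda>h. 0)) (at x)" for x
    using polys_has_derivative[OF assms(1), of x] assms(2) by simp
  then have "f x = f 0" for x
    using has_derivative_zero_unique[of UNIV f 0 x] by auto
  then show ?thesis by auto
qed

text \<open>Where \<open>norm h\<close> is maximal on the ball through x, the right side is at most
  \<open>sum \<kappa> J\<close> times that maximum, since isometries keep the ball. The extra m
  forces the maximum to be 0. The space is left general so that the lemma applies to points x and
  also to pairs (\<xi>, x).\<close>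

lemma max_principle:
  fixes h :: "'b::{heine_borel,real_normed_vector} \<Rightarrow> complex" and \<sigma> :: "'c \<Rightarrow> 'b \<Rightarrow> 'b"
  assumes h: "continuous_on UNIV h" and m: "m > 0" and nonneg: "\<And>j. j \<in> J \<Longrightarrow> \<kappa> j \<ge> 0"
    and iso: "\<And>j x. j \<in> J \<Longrightarrow> norm (\<sigma> j x) = norm x"
    and eq: "\<And>x. of_real (m + (\<Sum>j\<in>J. \<kappa> j)) * h x = (\<Sum>j\<in>J. of_real (\<kappa> j) * h (\<sigma> j x))"
  shows "h x = 0"
proof -
  define S where "S = cball (0::'b) (norm x)"
  have "compact S" "x \<in> S" by (auto simp: S_def)
  then obtain y where y: "y \<in> S" "\<And>z. z \<in> S \<Longrightarrow> norm (h z) \<le> norm (h y)"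
    using continuous_attains_sup[OF \<open>compact S\<close>, of "\<lambda>x. norm (h x)"]
      continuous_on_norm[OF continuous_on_subset[OF h subset_UNIV]] by blast
  have "norm (of_real (m + (\<Sum>j\<in>J. \<kappa> j)) * h y) \<le> (\<Sum>j\<in>J. \<kappa> j * norm (h y))"
    unfolding eq using y nonneg
    by (intro sum_norm_le) (auto simp: norm_mult S_def iso intro!: mult_left_mono)
  moreover have "(\<Sum>j\<in>J. \<kappa> j) \<ge> 0" using nonneg by (rule sum_nonneg)
  ultimately have "m * norm (h y) \<le> 0"
    using m by (simp add: norm_mult sum_distrib_right[symmetric] algebra_simps del: of_real_add)
  then have "norm (h y) \<le> 0" using m by (simp add: mult_le_0_iff)
  with y(2)[OF \<open>x \<in> S\<close>] show ?thesis by simp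
qed

section \<open>Dunkl operators\<close>

lemma inner_coroot: "x \<bullet> coroot \<alpha> = 2 * (x \<bullet> \<alpha>) / (\<alpha> \<bullet> \<alpha>)"
  by (simp add: coroot_def)

lemma root_refl_linear: "bounded_linear (root_refl \<alpha>)"
  unfolding root_refl_def
  by (intro bounded_linear_sub bounded_linear_ident bounded_linear_scaleR_const bounded_linear_inner_left)

lemma root_refl_scaleR: "root_refl \<alpha> (c *\<^sub>R x) = c *\<^sub>R root_refl \<alpha> x"
  using linear_scale[OF bounded_linear.linear[OF root_refl_linear]] .

lemma root_refl_inner [simp]: "root_refl \<alpha> x \<bullet> root_refl \<alpha> y = x \<bullet> y"
  by (cases "\<alpha> = 0") (simp_all add: root_refl_def inner_coroot algebra_simps inner_commute)

lemma norm_root_refl [simp]: "norm (root_refl \<alpha> x) = norm x"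
  by (simp add: norm_eq_sqrt_inner)

lemma root_refl_involution [simp]: "root_refl \<alpha> (root_refl \<alpha> x) = x"
  by (cases "\<alpha> = 0") (simp_all add: root_refl_def inner_coroot algebra_simps)

lemma inner_root_refl: "root_refl \<alpha> x \<bullet> v = x \<bullet> v - (\<alpha> \<bullet> x) * (coroot \<alpha> \<bullet> v)"
  by (simp add: root_refl_def coroot_def inner_diff_left inner_commute[of x \<alpha>])

lemma root_refl_zero [simp]: "root_refl 0 x = x"
  by (simp add: root_refl_def)

lemma root_refl_minus: "root_refl (- \<alpha>) = root_refl \<alpha>"
  by (auto simp: root_refl_def inner_coroot)

lemma root_refl_self: "\<alpha> \<noteq> 0 \<Longrightarrow> root_refl \<alpha> \<alpha> = - \<alpha>"
  by (simp add: root_refl_def inner_coroot scaleR_2)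

lemma root_refl_conjugate:
  "root_refl (root_refl \<beta> \<alpha>) (root_refl \<beta> x) = root_refl \<beta> (root_refl \<alpha> x)"
proof -
  interpret b: bounded_linear "root_refl \<beta>" by (rule root_refl_linear)
  show ?thesis
    by (simp add: root_refl_def[of "root_refl \<beta> \<alpha>"] root_refl_def[of \<alpha>] inner_coroot b.diff b.scaleR)
qed

section \<open>Divided differences along a root\<close>

lemma refl_quotient_exists:
  assumes "f \<in> polys" "\<alpha> \<noteq> 0"
  shows "\<exists>g. g \<in> polys \<and> (\<forall>x. of_real (\<alpha> \<bullet> x) * g x = f x - f (root_refl \<alpha> x))"
  using assms(1)
proof (induction rule: polys_induct)
  case (const c)
  show ?case by (rule exI[of _ "\<lambda>x. 0"]) auto
next
  case (inner v)
  have "of_real (\<alpha> \<bullet> x) * of_real (coroot \<alpha> \<bullet> v)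
    = complex_of_real (x \<bullet> v) - of_real (root_refl \<alpha> x \<bullet> v)" for x
    unfolding inner_root_refl by simp
  then show ?case by (intro exI[of _ "\<lambda>x. of_real (coroot \<alpha> \<bullet> v)"]) auto
next
  case (add f g)
  then obtain F G where "F \<in> polys" "\<forall>x. of_real (\<alpha> \<bullet> x) * F x = f x - f (root_refl \<alpha> x)"
    "G \<in> polys" "\<forall>x. of_real (\<alpha> \<bullet> x) * G x = g x - g (root_refl \<alpha> x)" by blast
  then show ?case
    by (intro exI[of _ "\<lambda>x. F x + G x"]) (auto simp: algebra_simps)
next
  case (mult f g)
  then obtain F G where *: "F \<in> polys" "\<forall>x. of_real (\<alpha> \<bullet> x) * F x = f x - f (root_refl \<alpha> x)"
    "G \<in> polys" "\<forall>x. of_real (\<alpha> \<bullet> x) * G x = g x - g (root_refl \<alpha> x)" by blast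
  show ?case
  proof (intro exI conjI allI)
    \<comment> \<open>The witness comes from the twisted Leibniz rule
      \<open>f g - f' g' = (f - f') g + f' (g - g')\<close>, where the prime denotes composition
      with the reflection.\<close>
    show "(\<lambda>x. F x * g x + f (root_refl \<alpha> x) * G x) \<in> polys"
      by (intro polys_add polys_mult polys_compose_linear[OF mult.hyps(1) root_refl_linear] * mult.hyps)
    fix x
    have "of_real (\<alpha> \<bullet> x) * (F x * g x + f (root_refl \<alpha> x) * G x)
        = (of_real (\<alpha> \<bullet> x) * F x) * g x + f (root_refl \<alpha> x) * (of_real (\<alpha> \<bullet> x) * G x)"
      by (simp add: algebra_simps)
    also have "\<dots> = (f x - f (root_refl \<alpha> x)) * g x + f (root_refl \<alpha> x) * (g x - g (root_refl \<alpha> x))"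
      using * by simp
    also have "\<dots> = f x * g x - f (root_refl \<alpha> x) * g (root_refl \<alpha> x)"
      by (simp add: algebra_simps)
    finally show "of_real (\<alpha> \<bullet> x) * (F x * g x + f (root_refl \<alpha> x) * G x)
      = f x * g x - f (root_refl \<alpha> x) * g (root_refl \<alpha> x)" .
  qed
qed

lemma refl_quotient_unique:
  assumes "\<alpha> \<noteq> 0" and g: "g \<in> polys" "\<And>x. of_real (\<alpha> \<bullet> x) * g x = f x - f (root_refl \<alpha> x)"
  shows "refl_quotient \<alpha> f = g"
  unfolding refl_quotient_def
proof (rule the_equality)
  fix h assume h: "h \<in> polys \<and> (\<forall>x. of_real (\<alpha> \<bullet> x) * h x = f x - f (root_refl \<alpha> x))"
  then have p: "(\<lambda>x. h x - g x) \<in> polys" using g by blast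
  have "h x - g x = 0" for x
    using h g(2) by (intro eq_zero_if_inner_mult_zero[OF polys_continuous[OF p] \<open>\<alpha> \<noteq> 0\<close>])
      (simp add: right_diff_distrib)
  then show "h = g" by auto
qed (use g in auto)

lemma refl_quotient_polys:
  "f \<in> polys \<Longrightarrow> \<alpha> \<noteq> 0 \<Longrightarrow> refl_quotient \<alpha> f \<in> polys"
  using refl_quotient_exists refl_quotient_unique by metis

lemma refl_quotient_eq:
  "f \<in> polys \<Longrightarrow> \<alpha> \<noteq> 0 \<Longrightarrow> of_real (\<alpha> \<bullet> x) * refl_quotient \<alpha> f x = f x - f (root_refl \<alpha> x)"
  using refl_quotient_exists refl_quotient_unique by metis

lemma refl_quotient_const: "\<alpha> \<noteq> 0 \<Longrightarrow> refl_quotient \<alpha> (\<lambda>x. c) = (\<lambda>x. 0)"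
  by (rule refl_quotient_unique) auto

lemma refl_quotient_add:
  assumes "f \<in> polys" "g \<in> polys" "\<alpha> \<noteq> 0"
  shows "refl_quotient \<alpha> (\<lambda>x. f x + g x) = (\<lambda>x. refl_quotient \<alpha> f x + refl_quotient \<alpha> g x)"
  using assms by (intro refl_quotient_unique) (auto simp: refl_quotient_polys refl_quotient_eq distrib_left)

lemma refl_quotient_cmult:
  assumes "f \<in> polys" "\<alpha> \<noteq> 0"
  shows "refl_quotient \<alpha> (\<lambda>x. c * f x) = (\<lambda>x. c * refl_quotient \<alpha> f x)"
proof (rule refl_quotient_unique)
  show "of_real (\<alpha> \<bullet> x) * (c * refl_quotient \<alpha> f x) = c * f x - c * f (root_refl \<alpha> x)" for x
    unfolding mult.left_commute[of _ c] refl_quotient_eq[OF assms] by (simp add: right_diff_distrib)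
qed (use assms in \<open>auto simp: refl_quotient_polys\<close>)

text \<open>The twisted Leibniz rule for a linear factor, whose own quotient is the constant
  \<open>coroot \<alpha> \<bullet> \<zeta>\<close>.\<close>

lemma refl_quotient_inner_mult:
  assumes "f \<in> polys" "\<alpha> \<noteq> 0"
  shows "refl_quotient \<alpha> (\<lambda>x. of_real (x \<bullet> \<zeta>) * f x)
    = (\<lambda>x. of_real (x \<bullet> \<zeta>) * refl_quotient \<alpha> f x + of_real (coroot \<alpha> \<bullet> \<zeta>) * f (root_refl \<alpha> x))"
proof (rule refl_quotient_unique)
  fix x
  show "of_real (\<alpha> \<bullet> x) * (of_real (x \<bullet> \<zeta>) * refl_quotient \<alpha> f x
      + of_real (coroot \<alpha> \<bullet> \<zeta>) * f (root_refl \<alpha> x))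
    = of_real (x \<bullet> \<zeta>) * f x - of_real (root_refl \<alpha> x \<bullet> \<zeta>) * f (root_refl \<alpha> x)"
  proof -
    have "of_real (\<alpha> \<bullet> x) * (of_real (x \<bullet> \<zeta>) * refl_quotient \<alpha> f x
        + of_real (coroot \<alpha> \<bullet> \<zeta>) * f (root_refl \<alpha> x))
      = of_real (x \<bullet> \<zeta>) * (of_real (\<alpha> \<bullet> x) * refl_quotient \<alpha> f x)
        + of_real (\<alpha> \<bullet> x) * of_real (coroot \<alpha> \<bullet> \<zeta>) * f (root_refl \<alpha> x)"
      by (simp add: algebra_simps)
    then show ?thesis
      unfolding refl_quotient_eq[OF assms] inner_root_refl by (simp add: algebra_simps)
  qed
qed (use assms in \<open>auto simp: refl_quotient_polys polys_compose_linear[OF assms(1) root_refl_linear]\<close>)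

lemma refl_quotient_minus:
  assumes "f \<in> polys" "\<alpha> \<noteq> 0"
  shows "refl_quotient (- \<alpha>) f = (\<lambda>x. - refl_quotient \<alpha> f x)"
proof (rule refl_quotient_unique)
  have "(\<lambda>x. (-1) * refl_quotient \<alpha> f x) \<in> polys"
    using assms by (intro polys_mult refl_quotient_polys) auto
  then show "(\<lambda>x. - refl_quotient \<alpha> f x) \<in> polys" by simp
qed (use assms in \<open>auto simp: root_refl_minus refl_quotient_eq\<close>)

lemma refl_quotient_compose_refl:
  assumes "f \<in> polys" "\<alpha> \<noteq> 0"
  shows "refl_quotient \<alpha> (\<lambda>x. f (root_refl \<beta> x))
    = (\<lambda>x. refl_quotient (root_refl \<beta> \<alpha>) f (root_refl \<beta> x))"
proof (rule refl_quotient_unique)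
  have nz: "root_refl \<beta> \<alpha> \<noteq> 0" using assms(2) norm_root_refl[of \<beta> \<alpha>]
    by (auto simp del: norm_root_refl)
  show "(\<lambda>x. refl_quotient (root_refl \<beta> \<alpha>) f (root_refl \<beta> x)) \<in> polys"
    by (rule polys_compose_linear[OF refl_quotient_polys[OF assms(1) nz] root_refl_linear])
  show "of_real (\<alpha> \<bullet> x) * refl_quotient (root_refl \<beta> \<alpha>) f (root_refl \<beta> x)
    = f (root_refl \<beta> x) - f (root_refl \<beta> (root_refl \<alpha> x))" for x
    using refl_quotient_eq[OF assms(1) nz, of "root_refl \<beta> x"]
    by (simp only: root_refl_conjugate root_refl_inner)
qed (rule assms(2))

lemma hom_polys_refl_quotient:
  assumes f: "f \<in> hom_polys n" and nz: "\<alpha> \<noteq> 0"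
  shows "refl_quotient \<alpha> f \<in> hom_polys (n - 1)"
proof (cases n)
  case 0
  with f nz show ?thesis by (auto simp: hom_polys_0 refl_quotient_const)
next
  case (Suc m)
  note fp = hom_polysD(1)[OF f]
  note Qp = refl_quotient_polys[OF fp nz]
  have "of_real c * refl_quotient \<alpha> f (c *\<^sub>R x) - of_real (c ^ Suc m) * refl_quotient \<alpha> f x = 0" for c x
  proof (rule eq_zero_if_inner_mult_zero[OF _ nz])
    have "(\<lambda>x. of_real c * refl_quotient \<alpha> f (c *\<^sub>R x) - of_real (c ^ Suc m) * refl_quotient \<alpha> f x) \<in> polys"
      by (intro polys_diff polys_mult polys_const Qp polys_compose_linear[OF Qp bounded_linear_scaleR_right])
    then show "continuous_on UNIV (\<lambda>x. of_real c * refl_quotient \<alpha> f (c *\<^sub>R x) - of_real (c ^ Suc m) * refl_quotient \<alpha> f x)"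
      by (rule polys_continuous)
    fix x
    have "of_real (\<alpha> \<bullet> x) * (of_real c * refl_quotient \<alpha> f (c *\<^sub>R x) - of_real (c ^ Suc m) * refl_quotient \<alpha> f x)
      = of_real (\<alpha> \<bullet> (c *\<^sub>R x)) * refl_quotient \<alpha> f (c *\<^sub>R x)
        - of_real (c ^ Suc m) * (of_real (\<alpha> \<bullet> x) * refl_quotient \<alpha> f x)"
      by (simp add: algebra_simps)
    also have "\<dots> = f (c *\<^sub>R x) - f (root_refl \<alpha> (c *\<^sub>R x)) - of_real (c ^ Suc m) * (f x - f (root_refl \<alpha> x))"
      unfolding refl_quotient_eq[OF fp nz] ..
    also have "\<dots> = 0"
      using hom_polysD(2)[OF f] Suc by (simp add: root_refl_scaleR algebra_simps)
    finally show "of_real (\<alpha> \<bullet> x) * (of_real c * refl_quotient \<alpha> f (c *\<^sub>R x) - of_real (c ^ Suc m) * refl_quotient \<alpha> f x) = 0" .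
  qed
  then show ?thesis using hom_polysI_mult[OF Qp, of m] Suc by simp
qed

section \<open>Root combinatorics and the calculus of Dunkl operators\<close>

locale dunkl =
  fixes R Rp :: "'a::euclidean_space set" and k :: "'a \<Rightarrow> real"
  assumes root_system: "root_system R"
    and positive: "positive_subsystem R Rp"
    and nonneg: "nonneg_multiplicity R k"
begin

lemma finite_R: "finite R" and zero_notin_R: "0 \<notin> R" and span_R: "span R = UNIV"
  and refl_R: "\<alpha> \<in> R \<Longrightarrow> root_refl \<alpha> ` R = R"
  using root_system by (auto simp: root_system_def)

lemma Rp_subset: "Rp \<subseteq> R"
  using positive by (auto simp: positive_subsystem_def)

lemma finite_Rp: "finite Rp"
  using Rp_subset finite_R finite_subset by blast

lemma root_nonzero: "\<alpha> \<in> R \<Longrightarrow> \<alpha> \<noteq> 0" "\<alpha> \<in> Rp \<Longrightarrow> \<alpha> \<noteq> 0"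
  using zero_notin_R Rp_subset by auto

lemma k_nonneg: "\<alpha> \<in> R \<Longrightarrow> k \<alpha> \<ge> 0" "\<alpha> \<in> Rp \<Longrightarrow> k \<alpha> \<ge> 0"
  using nonneg Rp_subset by (auto simp: nonneg_multiplicity_def)

lemma k_refl: "\<alpha> \<in> R \<Longrightarrow> \<beta> \<in> R \<Longrightarrow> k (root_refl \<beta> \<alpha>) = k \<alpha>"
  using nonneg refl_group_comp[OF refl_group_id, of \<beta> R] by (fastforce simp: nonneg_multiplicity_def)

lemma minus_root: "\<alpha> \<in> R \<Longrightarrow> - \<alpha> \<in> R" "\<alpha> \<in> R \<Longrightarrow> k (- \<alpha>) = k \<alpha>"
  using refl_R[of \<alpha>] root_refl_self[of \<alpha>] root_nonzero(1)[of \<alpha>] k_refl[of \<alpha> \<alpha>] by force+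

lemma R_decomp: "R = Rp \<union> uminus ` Rp" "Rp \<inter> uminus ` Rp = {}"
proof -
  obtain v where v: "\<forall>\<alpha>\<in>R. \<alpha> \<bullet> v \<noteq> 0" "Rp = {\<alpha>\<in>R. \<alpha> \<bullet> v > 0}"
    using positive by (auto simp: positive_subsystem_def)
  show "R = Rp \<union> uminus ` Rp"
  proof (intro equalityI subsetI)
    fix \<alpha> assume \<alpha>: "\<alpha> \<in> R"
    then have "\<alpha> \<bullet> v \<noteq> 0" using v(1) by blast
    then consider "\<alpha> \<bullet> v > 0" | "- \<alpha> \<bullet> v > 0" by (auto simp: neq_iff)
    then show "\<alpha> \<in> Rp \<union> uminus ` Rp"
    proof cases
      case 2
      then have "- \<alpha> \<in> Rp" using \<alpha> minus_root v by auto
      then show ?thesis by (auto intro: image_eqI[of _ uminus "- \<alpha>"])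
    qed (use v \<alpha> in auto)
  qed (use Rp_subset minus_root in auto)
  show "Rp \<inter> uminus ` Rp = {}" using v by auto
qed

abbreviation T :: "'a \<Rightarrow> ('a \<Rightarrow> complex) \<Rightarrow> 'a \<Rightarrow> complex" where "T \<equiv> dunkl_op Rp k"

lemma T_polys [intro]: "f \<in> polys \<Longrightarrow> T \<xi> f \<in> polys"
  unfolding dunkl_op_def
  by (intro polys_add polys_sum polys_mult polys_const refl_quotient_polys dir_deriv_polys root_nonzero)

lemma T_hom: "f \<in> hom_polys n \<Longrightarrow> T \<xi> f \<in> hom_polys (n - 1)"
  unfolding dunkl_op_def
  by (intro hom_polys_add hom_polys_sum hom_polys_cmult hom_polys_refl_quotient hom_polys_dir_deriv root_nonzero)

lemma T_const [simp]: "T \<xi> (\<lambda>x. c) = (\<lambda>x. 0)"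
  by (simp add: dunkl_op_def refl_quotient_const root_nonzero)

lemma T_add:
  assumes "f \<in> polys" "g \<in> polys"
  shows "T \<xi> (\<lambda>x. f x + g x) = (\<lambda>x. T \<xi> f x + T \<xi> g x)"
  using assms by (simp add: dunkl_op_def refl_quotient_add root_nonzero distrib_left sum.distrib algebra_simps)

lemma T_cmult:
  assumes "f \<in> polys"
  shows "T \<xi> (\<lambda>x. c * f x) = (\<lambda>x. c * T \<xi> f x)"
  using assms by (simp add: dunkl_op_def refl_quotient_cmult root_nonzero sum_distrib_left algebra_simps)

lemma T_diff:
  assumes "f \<in> polys" "g \<in> polys"
  shows "T \<xi> (\<lambda>x. f x - g x) = (\<lambda>x. T \<xi> f x - T \<xi> g x)"
  using T_add[OF assms(1) polys_mult[OF polys_const assms(2)], of \<xi> "-1"] T_cmult[OF assms(2), of \<xi> "-1"]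
  by simp

lemma T_sum:
  assumes "\<And>i. i \<in> I \<Longrightarrow> f i \<in> polys"
  shows "T \<xi> (\<lambda>x. \<Sum>i\<in>I. f i x) = (\<lambda>x. \<Sum>i\<in>I. T \<xi> (f i) x)"
  using assms by (induction I rule: infinite_finite_induct) (auto simp: T_add polys_sum)

lemma T_linear:
  assumes "f \<in> polys"
  shows "linear (\<lambda>\<xi>. T \<xi> f x)"
proof -
  interpret D: linear "\<lambda>\<xi>. dir_deriv \<xi> f x" using assms by (rule dir_deriv_linear)
  show ?thesis
    by (rule linearI)
       (simp_all add: dunkl_op_def D.add D.scale algebra_simps sum.distrib scaleR_sum_right scaleR_conv_of_real sum_distrib_left)
qed

text \<open>When the direction is the base point itself, the factor
  \<open>\<alpha> \<bullet> x\<close> cancels the denominator of the quotient. This contraction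
  produces the radial equation.\<close>

lemma T_point:
  assumes "f \<in> polys"
  shows "T x f x = dir_deriv x f x + (\<Sum>\<alpha>\<in>Rp. of_real (k \<alpha>) * (f x - f (root_refl \<alpha> x)))"
  using assms by (simp add: dunkl_op_def mult.assoc refl_quotient_eq root_nonzero)

lemma T_inner_mult:
  assumes "f \<in> polys"
  shows "T \<xi> (\<lambda>x. of_real (x \<bullet> \<zeta>) * f x) = (\<lambda>x. of_real (x \<bullet> \<zeta>) * T \<xi> f x + of_real (\<xi> \<bullet> \<zeta>) * f x
    + (\<Sum>\<alpha>\<in>Rp. of_real (k \<alpha> * (\<alpha> \<bullet> \<xi>) * (coroot \<alpha> \<bullet> \<zeta>)) * f (root_refl \<alpha> x)))"
proof -
  have "(\<Sum>\<alpha>\<in>Rp. of_real (k \<alpha> * (\<alpha> \<bullet> \<xi>)) * refl_quotient \<alpha> (\<lambda>x. of_real (x \<bullet> \<zeta>) * f x) x)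
    = of_real (x \<bullet> \<zeta>) * (\<Sum>\<alpha>\<in>Rp. of_real (k \<alpha> * (\<alpha> \<bullet> \<xi>)) * refl_quotient \<alpha> f x)
      + (\<Sum>\<alpha>\<in>Rp. of_real (k \<alpha> * (\<alpha> \<bullet> \<xi>) * (coroot \<alpha> \<bullet> \<zeta>)) * f (root_refl \<alpha> x))" for x
    unfolding sum_distrib_left sum.distrib[symmetric] using assms
    by (intro sum.cong refl) (simp add: refl_quotient_inner_mult root_nonzero distrib_left mult.left_commute mult.assoc)
  then show ?thesis
    using assms by (simp add: dunkl_op_def distrib_left add_ac)
qed

text \<open>Each summand is even in \<alpha>, so R counts it twice. R, unlike \<open>Rp\<close>, is
  permuted by every reflection, which makes this form suited to equivariance.\<close>

lemma T_over_R:
  assumes "f \<in> polys"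
  shows "T \<xi> f x = dir_deriv \<xi> f x + (\<Sum>\<alpha>\<in>R. of_real (k \<alpha> * (\<alpha> \<bullet> \<xi>)) * refl_quotient \<alpha> f x) / 2"
proof -
  let ?t = "\<lambda>\<alpha>. of_real (k \<alpha> * (\<alpha> \<bullet> \<xi>)) * refl_quotient \<alpha> f x"
  have "(\<Sum>\<alpha>\<in>R. ?t \<alpha>) = (\<Sum>\<alpha>\<in>Rp. ?t \<alpha>) + (\<Sum>\<alpha>\<in>uminus ` Rp. ?t \<alpha>)"
    by (subst R_decomp(1)) (use finite_Rp R_decomp(2) in \<open>simp add: sum.union_disjoint\<close>)
  also have "(\<Sum>\<alpha>\<in>uminus ` Rp. ?t \<alpha>) = (\<Sum>\<alpha>\<in>Rp. ?t (- \<alpha>))"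
    by (simp add: sum.reindex)
  also have "\<dots> = (\<Sum>\<alpha>\<in>Rp. ?t \<alpha>)"
    using assms Rp_subset by (intro sum.cong refl) (auto simp: minus_root refl_quotient_minus root_nonzero)
  finally show ?thesis by (simp add: dunkl_op_def)
qed

text \<open>Equivariance: the sum over R is reindexed by the permutation
  \<open>root_refl \<beta>\<close>, under which k is invariant and the quotients are
  conjugated.\<close>

lemma T_compose_refl:
  assumes f: "f \<in> polys" and \<beta>: "\<beta> \<in> R"
  shows "T \<xi> (\<lambda>x. f (root_refl \<beta> x)) x = T (root_refl \<beta> \<xi>) f (root_refl \<beta> x)"
proof -
  note fp = polys_compose_linear[OF f root_refl_linear]
  have inj: "inj_on (root_refl \<beta>) R" by (rule inj_on_inverseI[of _ "root_refl \<beta>"]) simp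
  have "(\<Sum>\<alpha>\<in>R. of_real (k \<alpha> * (\<alpha> \<bullet> root_refl \<beta> \<xi>)) * refl_quotient \<alpha> f (root_refl \<beta> x))
    = (\<Sum>\<alpha>\<in>root_refl \<beta> ` R. of_real (k \<alpha> * (\<alpha> \<bullet> root_refl \<beta> \<xi>)) * refl_quotient \<alpha> f (root_refl \<beta> x))"
    using refl_R[OF \<beta>] by simp
  also have "\<dots> = (\<Sum>\<alpha>\<in>R. of_real (k \<alpha> * (\<alpha> \<bullet> \<xi>)) * refl_quotient \<alpha> (\<lambda>x. f (root_refl \<beta> x)) x)"
    unfolding sum.reindex[OF inj] o_def
    using f \<beta> by (intro sum.cong refl) (simp add: k_refl refl_quotient_compose_refl root_nonzero)
  finally show ?thesis
    using f fp by (simp add: T_over_R dir_deriv_compose_linear root_refl_linear)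
qed

lemma T_compose_refl':
  assumes f: "f \<in> polys" and \<alpha>: "\<alpha> \<in> Rp"
  shows "T \<xi> (\<lambda>x. f (root_refl \<alpha> x)) x
    = T \<xi> f (root_refl \<alpha> x) - of_real (\<xi> \<bullet> coroot \<alpha>) * T \<alpha> f (root_refl \<alpha> x)"
proof -
  interpret D: linear "\<lambda>\<xi>. T \<xi> f y" for y using f by (rule T_linear)
  have "T \<xi> (\<lambda>x. f (root_refl \<alpha> x)) x = T (\<xi> - (\<xi> \<bullet> coroot \<alpha>) *\<^sub>R \<alpha>) f (root_refl \<alpha> x)"
    using T_compose_refl[OF f] \<alpha> Rp_subset by (auto simp: root_refl_def[of \<alpha> \<xi>])
  then show ?thesis by (simp add: D.diff D.scale scaleR_conv_of_real)
qed

subsection \<open>Commutativity\<close>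

text \<open>By \<open>TT\<close> below, the commutator of two Dunkl operators commutes with multiplication by linear
  forms; as it annihilates constants, it vanishes.\<close>

lemma T_commute:
  assumes f: "f \<in> polys"
  shows "T \<xi> (T \<eta> f) = T \<eta> (T \<xi> f)"
proof -
  define C where "C f x = T \<xi> (T \<eta> f) x - T \<eta> (T \<xi> f) x" for f x
  have TT: "T \<xi> (T \<eta> (\<lambda>x. of_real (x \<bullet> \<zeta>) * f x)) x =
      of_real (x \<bullet> \<zeta>) * T \<xi> (T \<eta> f) x + of_real (\<xi> \<bullet> \<zeta>) * T \<eta> f x + of_real (\<eta> \<bullet> \<zeta>) * T \<xi> f x
      + (\<Sum>\<alpha>\<in>Rp. of_real (k \<alpha> * (coroot \<alpha> \<bullet> \<zeta>) * (\<alpha> \<bullet> \<xi>)) * T \<eta> f (root_refl \<alpha> x))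
      + (\<Sum>\<alpha>\<in>Rp. of_real (k \<alpha> * (coroot \<alpha> \<bullet> \<zeta>) * (\<alpha> \<bullet> \<eta>)) * T \<xi> f (root_refl \<alpha> x))
      - (\<Sum>\<alpha>\<in>Rp. of_real (k \<alpha> * (coroot \<alpha> \<bullet> \<zeta>) * (2 * (\<alpha> \<bullet> \<xi>) * (\<alpha> \<bullet> \<eta>) / (\<alpha> \<bullet> \<alpha>))) * T \<alpha> f (root_refl \<alpha> x))"
    if f: "f \<in> polys" for f \<xi> \<eta> \<zeta> x
  proof -
    have fr: "(\<lambda>x. f (root_refl \<alpha> x)) \<in> polys" for \<alpha>
      using f root_refl_linear by (rule polys_compose_linear)
    have p1: "(\<lambda>x. of_real (x \<bullet> \<zeta>) * T \<eta> f x) \<in> polys" "(\<lambda>x. of_real (\<eta> \<bullet> \<zeta>) * f x) \<in> polys"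
      using f by auto
    have p2: "(\<lambda>x. of_real (k \<alpha> * (\<alpha> \<bullet> \<eta>) * (coroot \<alpha> \<bullet> \<zeta>)) * f (root_refl \<alpha> x)) \<in> polys" for \<alpha>
      by (rule polys_mult[OF polys_const fr])
    have "T \<xi> (T \<eta> (\<lambda>x. of_real (x \<bullet> \<zeta>) * f x)) x
      = T \<xi> (\<lambda>x. of_real (x \<bullet> \<zeta>) * T \<eta> f x) x + T \<xi> (\<lambda>x. of_real (\<eta> \<bullet> \<zeta>) * f x) x
        + (\<Sum>\<alpha>\<in>Rp. T \<xi> (\<lambda>x. of_real (k \<alpha> * (\<alpha> \<bullet> \<eta>) * (coroot \<alpha> \<bullet> \<zeta>)) * f (root_refl \<alpha> x)) x)"
      unfolding T_inner_mult[OF f] by (simp only: T_add p1 p2 polys_add polys_sum T_sum)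
    also have "(\<Sum>\<alpha>\<in>Rp. T \<xi> (\<lambda>x. of_real (k \<alpha> * (\<alpha> \<bullet> \<eta>) * (coroot \<alpha> \<bullet> \<zeta>)) * f (root_refl \<alpha> x)) x)
      = (\<Sum>\<alpha>\<in>Rp. of_real (k \<alpha> * (coroot \<alpha> \<bullet> \<zeta>) * (\<alpha> \<bullet> \<eta>)) * T \<xi> f (root_refl \<alpha> x)
       - of_real (k \<alpha> * (coroot \<alpha> \<bullet> \<zeta>) * (2 * (\<alpha> \<bullet> \<xi>) * (\<alpha> \<bullet> \<eta>) / (\<alpha> \<bullet> \<alpha>))) * T \<alpha> f (root_refl \<alpha> x))"
      unfolding T_cmult[OF fr]
      by (intro sum.cong refl, subst T_compose_refl'[OF f])
         (auto simp: inner_coroot algebra_simps inner_commute)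
    also have "T \<xi> (\<lambda>x. of_real (x \<bullet> \<zeta>) * T \<eta> f x) x = of_real (x \<bullet> \<zeta>) * T \<xi> (T \<eta> f) x + of_real (\<xi> \<bullet> \<zeta>) * T \<eta> f x
        + (\<Sum>\<alpha>\<in>Rp. of_real (k \<alpha> * (coroot \<alpha> \<bullet> \<zeta>) * (\<alpha> \<bullet> \<xi>)) * T \<eta> f (root_refl \<alpha> x))"
      unfolding T_inner_mult[OF T_polys[OF f]] by (simp add: mult_ac)
    finally show ?thesis
      unfolding T_cmult[OF f] sum_subtractf by (simp only: add_ac diff_conv_add_uminus)
  qed
  \<comment> \<open>Apart from its first term, the right side of \<open>TT\<close> is symmetric in
    \<xi> and \<eta>, so only that term survives in the commutator.\<close>
  have C_inner: "C (\<lambda>x. of_real (x \<bullet> \<zeta>) * f x) = (\<lambda>x. of_real (x \<bullet> \<zeta>) * C f x)" if f: "f \<in> polys" for f \<zeta>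
    unfolding C_def TT[OF f] by (rule ext) (simp add: algebra_simps)
  have C_add: "C (\<lambda>x. f x + g x) = (\<lambda>x. C f x + C g x)" if "f \<in> polys" "g \<in> polys" for f g
    unfolding C_def using that by (auto simp: T_add T_polys)
  have C_cmult: "C (\<lambda>x. c * f x) = (\<lambda>x. c * C f x)" if "f \<in> polys" for f c
    unfolding C_def using that by (auto simp: T_cmult T_polys right_diff_distrib)
  \<comment> \<open>The second factor g stays arbitrary so that in the product case the two
    multipliers can be pulled out one after the other; afterwards \<open>g = 1\<close>
    suffices.\<close>
  have "\<forall>g\<in>polys. C (\<lambda>x. f x * g x) = (\<lambda>x. f x * C g x)" using f
  proof (induction rule: polys_induct)
    case (add f g)
    then show ?case by (auto simp: distrib_right C_add)
  next
    case (mult f g)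
    then show ?case by (auto simp: mult.assoc)
  qed (auto simp: C_inner C_cmult)
  then have "C (\<lambda>x. f x * 1) = (\<lambda>x. f x * C (\<lambda>x. 1) x)" by (rule bspec) (rule polys_const)
  also have "\<dots> = (\<lambda>x. 0)" by (simp add: C_def)
  finally show ?thesis by (auto simp: C_def fun_eq_iff)
qed

subsection \<open>Integrating compatible families\<close>

lemma radial_equation_unique:
  assumes g: "g \<in> polys" and n: "n > 0"
    and eq: "\<And>x. of_nat n * g x + (\<Sum>\<alpha>\<in>Rp. of_real (k \<alpha>) * (g x - g (root_refl \<alpha> x))) = 0"
  shows "g x = 0"
proof (rule max_principle[where h = g and m = "real n" and J = Rp and \<kappa> = k and \<sigma> = root_refl])
  show "continuous_on UNIV g" using g by (rule polys_continuous)
  show "of_real (real n + sum k Rp) * g x = (\<Sum>\<alpha>\<in>Rp. of_real (k \<alpha>) * g (root_refl \<alpha> x))" for x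
    using eq[of x] by (simp add: algebra_simps sum_subtractf sum_distrib_left)
qed (use n k_nonneg in auto)

text \<open>By \<open>T_point\<close> and \<open>euler_identity\<close>, \<open>T x g x = 0\<close>
  is the homogeneous radial equation, which has only the zero solution in positive degree.\<close>

lemma eq_zero_if_T_zero:
  assumes g: "g \<in> hom_polys n" and n: "n > 0" and T: "\<And>\<xi>. T \<xi> g = (\<lambda>x. 0)"
  shows "g = (\<lambda>x. 0)"
proof
  fix x
  note gp = hom_polysD(1)[OF g]
  have "of_nat n * g x + (\<Sum>\<alpha>\<in>Rp. of_real (k \<alpha>) * (g x - g (root_refl \<alpha> x))) = T x g x" for x
    unfolding T_point[OF gp] euler_identity[OF g] ..
  with T show "g x = 0" by (intro radial_equation_unique[OF gp n]) simp
qed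

text \<open>The radial equation fixes only the contraction \<open>T x g x = h x x\<close>. Applying
  \<open>T \<xi>\<close> to it and using the compatibility of h yields for the defect
  \<open>d \<xi> x = T \<xi> g x - h \<xi> x\<close> an averaging equation in which the reflections
  act on \<xi> and x at once; \<open>max_principle\<close> on pairs then gives
  \<open>d = 0\<close>.\<close>

lemma T_eq_if_radial_equation:
  assumes g: "g \<in> hom_polys n" and n: "n > 0"
    and h: "\<And>\<xi>. h \<xi> \<in> hom_polys (n - 1)" and lin: "\<And>x. linear (\<lambda>\<xi>. h \<xi> x)"
    and compat: "\<And>\<xi> \<eta>. T \<xi> (h \<eta>) = T \<eta> (h \<xi>)"
    and eq: "\<And>x. of_nat n * g x + (\<Sum>\<alpha>\<in>Rp. of_real (k \<alpha>) * (g x - g (root_refl \<alpha> x))) = h x x"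
  shows "T \<xi> g x = h \<xi> x"
proof -
  note gp = hom_polysD(1)[OF g] and hp = hom_polysD(1)[OF h]
  note gr = polys_compose_linear[OF gp root_refl_linear]
  define d where "d \<xi> x = T \<xi> g x - h \<xi> x" for \<xi> x
  have d_lin: "linear (\<lambda>\<xi>. d \<xi> x)" for x
    unfolding d_def using T_linear[OF gp, of x] lin by (rule linear_compose_sub)
  have d_polys: "d \<xi> \<in> polys" for \<xi>
    unfolding d_def using gp hp by auto
  have main: "of_real (real n + sum k Rp) * d \<xi> x
      = (\<Sum>\<alpha>\<in>Rp. of_real (k \<alpha>) * d (root_refl \<alpha> \<xi>) (root_refl \<alpha> x))" for \<xi> x
  proof -
    have R: "of_nat n * T \<xi> g x + (\<Sum>\<alpha>\<in>Rp. of_real (k \<alpha>) * (T \<xi> g x - T (root_refl \<alpha> \<xi>) g (root_refl \<alpha> x)))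
      = T \<xi> (\<lambda>x. of_nat n * g x + (\<Sum>\<alpha>\<in>Rp. of_real (k \<alpha>) * (g x - g (root_refl \<alpha> x)))) x"
    proof -
      have "T \<xi> (\<lambda>x. of_nat n * g x + (\<Sum>\<alpha>\<in>Rp. of_real (k \<alpha>) * (g x - g (root_refl \<alpha> x)))) x
        = of_nat n * T \<xi> g x + (\<Sum>\<alpha>\<in>Rp. of_real (k \<alpha>) * (T \<xi> g x - T \<xi> (\<lambda>x. g (root_refl \<alpha> x)) x))"
        by (simp only: T_add T_sum T_cmult T_diff polys_sum polys_mult polys_const polys_diff gp gr)
      also have "\<dots> = of_nat n * T \<xi> g x + (\<Sum>\<alpha>\<in>Rp. of_real (k \<alpha>) * (T \<xi> g x - T (root_refl \<alpha> \<xi>) g (root_refl \<alpha> x)))"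
        using Rp_subset by (intro arg_cong2[where f = "(+)"] sum.cong refl) (auto simp: T_compose_refl[OF gp])
      finally show ?thesis by simp
    qed
    \<comment> \<open>In \<open>h x x\<close> the point is also the direction. The basis expansion
      separates the two roles, so that \<open>T_inner_mult\<close> applies to each summand.\<close>
    have "(\<lambda>x. of_nat n * g x + (\<Sum>\<alpha>\<in>Rp. of_real (k \<alpha>) * (g x - g (root_refl \<alpha> x))))
      = (\<lambda>x. \<Sum>b\<in>Basis. of_real (x \<bullet> b) * h b x)"
      unfolding eq using linear_expand_Basis[OF lin] by (rule ext)
    then have "T \<xi> (\<lambda>x. of_nat n * g x + (\<Sum>\<alpha>\<in>Rp. of_real (k \<alpha>) * (g x - g (root_refl \<alpha> x)))) x
      = (\<Sum>b\<in>Basis. T \<xi> (\<lambda>x. of_real (x \<bullet> b) * h b x) x)"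
      using hp by (simp add: T_sum)
    \<comment> \<open>\<open>compat\<close> trades \<open>T \<xi> (h b)\<close> for
      \<open>T b (h \<xi>)\<close>, so the first sum contracts to \<open>T x (h \<xi>) x\<close>,
      which \<open>T_point\<close> and \<open>euler_identity\<close> evaluate.\<close>
    also have "\<dots> = (\<Sum>b\<in>Basis. of_real (x \<bullet> b) * T b (h \<xi>) x) + (\<Sum>b\<in>Basis. of_real (\<xi> \<bullet> b) * h b x)
      + (\<Sum>b\<in>Basis. \<Sum>\<alpha>\<in>Rp. of_real (k \<alpha> * (\<alpha> \<bullet> \<xi>) * (coroot \<alpha> \<bullet> b)) * h b (root_refl \<alpha> x))"
      by (simp add: T_inner_mult[OF hp] compat[of \<xi>] sum.distrib)
    also have "(\<Sum>b\<in>Basis. of_real (x \<bullet> b) * T b (h \<xi>) x) = T x (h \<xi>) x"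
      by (rule linear_expand_Basis[OF T_linear[OF hp], symmetric])
    also have "(\<Sum>b\<in>Basis. of_real (\<xi> \<bullet> b) * h b x) = h \<xi> x"
      by (rule linear_expand_Basis[OF lin, symmetric])
    also have "(\<Sum>b\<in>Basis. \<Sum>\<alpha>\<in>Rp. of_real (k \<alpha> * (\<alpha> \<bullet> \<xi>) * (coroot \<alpha> \<bullet> b)) * h b (root_refl \<alpha> x))
      = (\<Sum>\<alpha>\<in>Rp. of_real (k \<alpha> * (\<alpha> \<bullet> \<xi>)) * (\<Sum>b\<in>Basis. of_real (coroot \<alpha> \<bullet> b) * h b (root_refl \<alpha> x)))"
      by (subst sum.swap) (simp add: sum_distrib_left mult.assoc)
    \<comment> \<open>By linearity in the direction, since \<open>(\<alpha> \<bullet> \<xi>)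
      *\<^sub>R coroot \<alpha> = \<xi> - root_refl \<alpha> \<xi>\<close>.\<close>
    also have "\<dots> = (\<Sum>\<alpha>\<in>Rp. of_real (k \<alpha>) * (h \<xi> (root_refl \<alpha> x) - h (root_refl \<alpha> \<xi>) (root_refl \<alpha> x)))"
    proof (intro sum.cong refl)
      fix \<alpha>
      interpret L: linear "\<lambda>\<xi>. h \<xi> (root_refl \<alpha> x)" by (rule lin)
      show "of_real (k \<alpha> * (\<alpha> \<bullet> \<xi>)) * (\<Sum>b\<in>Basis. of_real (coroot \<alpha> \<bullet> b) * h b (root_refl \<alpha> x))
        = of_real (k \<alpha>) * (h \<xi> (root_refl \<alpha> x) - h (root_refl \<alpha> \<xi>) (root_refl \<alpha> x))"
        unfolding linear_expand_Basis[OF lin, of "coroot \<alpha>", symmetric]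
        by (simp add: root_refl_def[of \<alpha> \<xi>] L.diff L.scale coroot_def scaleR_conv_of_real inner_commute)
    qed
    also have "T x (h \<xi>) x = of_nat (n - 1) * h \<xi> x + (\<Sum>\<alpha>\<in>Rp. of_real (k \<alpha>) * (h \<xi> x - h \<xi> (root_refl \<alpha> x)))"
      by (simp add: T_point[OF hp] euler_identity[OF h])
    \<comment> \<open>The degree \<open>n - 1\<close> of \<open>h \<xi>\<close> and the single
      \<open>h \<xi> x\<close> from the Leibniz rule add up to n because \<open>n > 0\<close>; the
      terms \<open>h \<xi> (root_refl \<alpha> x)\<close> cancel.\<close>
    finally have "of_nat n * T \<xi> g x + (\<Sum>\<alpha>\<in>Rp. of_real (k \<alpha>) * (T \<xi> g x - T (root_refl \<alpha> \<xi>) g (root_refl \<alpha> x)))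
      = of_nat n * h \<xi> x + (\<Sum>\<alpha>\<in>Rp. of_real (k \<alpha>) * (h \<xi> x - h (root_refl \<alpha> \<xi>) (root_refl \<alpha> x)))"
      using n unfolding R by (simp add: sum_subtractf algebra_simps)
    then show ?thesis
      by (simp add: d_def algebra_simps sum_subtractf sum_distrib_left)
  qed
  have "(\<lambda>p. d (fst p) (snd p)) (\<xi>, x) = 0"
  proof (rule max_principle[where m = "real n" and J = Rp and \<kappa> = k
        and \<sigma> = "\<lambda>\<alpha> p. (root_refl \<alpha> (fst p), root_refl \<alpha> (snd p))"])
    show "continuous_on UNIV (\<lambda>p. d (fst p) (snd p))"
      \<comment> \<open>Joint continuity: linearity in \<xi> reduces d to the finitely many
        polynomials \<open>d b\<close>.\<close>
      by (subst linear_expand_Basis[OF d_lin])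
         (intro continuous_intros continuous_on_compose2[OF polys_continuous[OF d_polys, of UNIV]] subset_UNIV)
  qed (use n k_nonneg main in \<open>auto simp: norm_prod_def\<close>)
  then show ?thesis by (simp add: d_def)
qed

end

section \<open>The random series\<close>

text \<open>If jumps occur at rate \<open>N / t\<close> as t decreases from 1, there is none before
  time s with probability \<open>s ^ N\<close>; this is the resulting law of the first jump
  time.\<close>

definition scale_measure :: "nat \<Rightarrow> real measure" where
  "scale_measure N = density lborel (\<lambda>s. ennreal (real N * s ^ (N - 1) * indicator {0..1} s))"

lemma sets_scale_measure [measurable_cong, simp]: "sets (scale_measure N) = sets borel"
  by (simp add: scale_measure_def)

lemma space_scale_measure [simp]: "space (scale_measure N) = UNIV"
  by (simp add: scale_measure_def)

lemma prob_space_scale_measure: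
  assumes "N > 0"
  shows "prob_space (scale_measure N)"
proof
  have "emeasure (scale_measure N) UNIV
      = (\<integral>\<^sup>+s. ennreal (real N * s ^ (N - 1)) * indicator {0..1} s \<partial>lborel)"
    unfolding scale_measure_def
    by (subst emeasure_density) (auto intro!: nn_integral_cong split: split_indicator)
  also have "\<dots> = ennreal (1 ^ N - 0 ^ N)"
    by (rule nn_integral_FTC_Icc) (auto intro!: derivative_eq_intros)
  finally show "emeasure (scale_measure N) (space (scale_measure N)) = 1"
    using assms by simp
qed

text \<open>With the density included, the integrand is the derivative of
  \<open>N * s ^ N * \<phi> s\<close>, whose value at 0 vanishes because
  \<open>N > 0\<close>.\<close>

lemma integral_scale_measure_FTC:
  fixes \<phi> \<phi>' :: "real \<Rightarrow> complex"
  assumes N: "N > 0" and g: "g \<in> borel_measurable borel"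
    and deriv: "\<And>s. (\<phi> has_vector_derivative \<phi>' s) (at s)" and cont: "continuous_on UNIV \<phi>'"
    and eq: "\<And>s. 0 \<le> s \<Longrightarrow> s \<le> 1 \<Longrightarrow> g s = of_nat N * \<phi> s + of_real s * \<phi>' s"
  shows "(\<integral>s. g s \<partial>scale_measure N) = of_nat N * \<phi> 1"
proof -
  define F where "F s = (real N * s ^ N) *\<^sub>R \<phi> s" for s
  define f where "f s = (real N * s ^ (N - 1)) *\<^sub>R (of_nat N * \<phi> s + of_real s * \<phi>' s)" for s
  have cont\<phi>: "continuous_on UNIV \<phi>"
    using deriv by (auto intro!: continuous_at_imp_continuous_on has_vector_derivative_continuous)
  have F': "(F has_vector_derivative f s) (at s within A)" for s A
  proof -
    have "(F has_vector_derivative ((real N * s ^ N) *\<^sub>R \<phi>' s + (real N * (real N * s ^ (N - 1))) *\<^sub>R \<phi> s)) (at s within A)"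
      unfolding F_def
      by (rule has_vector_derivative_scaleR[OF _ has_vector_derivative_at_within[OF deriv]])
         (auto intro!: derivative_eq_intros)
    also have "(real N * s ^ N) *\<^sub>R \<phi>' s + (real N * (real N * s ^ (N - 1))) *\<^sub>R \<phi> s = f s"
      using N by (cases N) (auto simp: f_def scaleR_conv_of_real algebra_simps)
    finally show ?thesis .
  qed
  have "(\<integral>s. g s \<partial>scale_measure N) = (\<integral>s. (real N * s ^ (N - 1) * indicator {0..1} s) *\<^sub>R g s \<partial>lborel)"
    unfolding scale_measure_def using g by (intro integral_density) (auto split: split_indicator)
  also have "\<dots> = (\<integral>s. indicator {0..1} s *\<^sub>R f s \<partial>lborel)"
    by (intro Bochner_Integration.integral_cong refl) (auto simp: f_def eq split: split_indicator)
  also have "\<dots> = F 1 - F 0"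
  proof (rule integral_FTC_Icc)
    show "continuous_on {0..1} f"
      unfolding f_def using cont cont\<phi>
      by (intro continuous_intros) (auto intro: continuous_on_subset)
  qed (use F' in auto)
  also have "\<dots> = of_nat N * \<phi> 1"
    using N by (simp add: F_def scaleR_conv_of_real)
  finally show ?thesis .
qed

section \<open>Integration over streams by splitting off the first entry\<close>

lemma (in prob_space) distr_stream_space_Stream:
  "distr (M \<Otimes>\<^sub>M stream_space M) (stream_space M) (\<lambda>(x, \<omega>). x ## \<omega>) = stream_space M"
proof (rule measure_eqI)
  interpret S: prob_space "stream_space M" by (rule prob_space_stream_space)
  fix A assume "A \<in> sets (distr (M \<Otimes>\<^sub>M stream_space M) (stream_space M) (\<lambda>(x, \<omega>). x ## \<omega>))"
  then have A [measurable]: "A \<in> sets (stream_space M)" by simp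
  have "emeasure (distr (M \<Otimes>\<^sub>M stream_space M) (stream_space M) (\<lambda>(x, \<omega>). x ## \<omega>)) A
    = (\<integral>\<^sup>+p. indicator A (fst p ## snd p) \<partial>(M \<Otimes>\<^sub>M stream_space M))"
    by (subst nn_integral_indicator[symmetric], simp, subst nn_integral_distr) (auto simp: case_prod_unfold)
  also have "\<dots> = (\<integral>\<^sup>+x. \<integral>\<^sup>+\<omega>. indicator A (x ## \<omega>) \<partial>stream_space M \<partial>M)"
    by (subst S.nn_integral_fst[symmetric]) auto
  also have "\<dots> = emeasure (stream_space M) A"
    by (subst nn_integral_stream_space[symmetric]) auto
  finally show "emeasure (distr (M \<Otimes>\<^sub>M stream_space M) (stream_space M) (\<lambda>(x, \<omega>). x ## \<omega>)) A
    = emeasure (stream_space M) A" .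
qed simp

text \<open>Fubini with the head innermost: the tail is frozen while the first step is integrated
  out, which is the conditioning used in \<open>V_radial_equation\<close>.\<close>

lemma (in prob_space) integral_stream_space:
  fixes f :: "'a stream \<Rightarrow> 'b::{banach, second_countable_topology}"
  assumes f: "integrable (stream_space M) f"
  shows "(\<integral>\<omega>. f \<omega> \<partial>stream_space M) = (\<integral>\<omega>. \<integral>x. f (x ## \<omega>) \<partial>M \<partial>stream_space M)"
proof -
  interpret S: prob_space "stream_space M" by (rule prob_space_stream_space)
  interpret pair_sigma_finite M "stream_space M" ..
  have [measurable]: "f \<in> borel_measurable (stream_space M)" using f by auto
  have "integrable (distr (M \<Otimes>\<^sub>M stream_space M) (stream_space M) (\<lambda>(x, \<omega>). x ## \<omega>)) f"
    using f by (simp only: distr_stream_space_Stream)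
  then have int: "integrable (M \<Otimes>\<^sub>M stream_space M) (\<lambda>(x, \<omega>). f (x ## \<omega>))"
    by (subst (asm) integrable_distr_eq) (auto simp: case_prod_unfold)
  have "(\<integral>\<omega>. f \<omega> \<partial>stream_space M)
    = (\<integral>\<omega>. f \<omega> \<partial>distr (M \<Otimes>\<^sub>M stream_space M) (stream_space M) (\<lambda>(x, \<omega>). x ## \<omega>))"
    by (simp only: distr_stream_space_Stream)
  also have "\<dots> = (\<integral>p. (case p of (x, \<omega>) \<Rightarrow> f (x ## \<omega>)) \<partial>(M \<Otimes>\<^sub>M stream_space M))"
    by (subst integral_distr) (auto simp: case_prod_unfold)
  also have "\<dots> = (\<integral>\<omega>. \<integral>x. f (x ## \<omega>) \<partial>M \<partial>stream_space M)"
    by (rule integral_snd[OF int, symmetric])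
  finally show ?thesis .
qed

text \<open>Finite sums of products c(\<omega>) p(x). Integrating such a function over \<omega>
  leaves a linear combination of the p, which is how \<open>V\<close> is seen to preserve
  polynomials.\<close>

inductive_set separable :: "('b \<Rightarrow> complex) set \<Rightarrow> ('c \<Rightarrow> complex) set \<Rightarrow> ('b \<Rightarrow> 'c \<Rightarrow> complex) set"
  for A B where
    separable_zero: "(\<lambda>\<omega> x. 0) \<in> separable A B"
  | separable_step: "c \<in> A \<Longrightarrow> p \<in> B \<Longrightarrow> G \<in> separable A B \<Longrightarrow> (\<lambda>\<omega> x. c \<omega> * p x + G \<omega> x) \<in> separable A B"

lemma separable_single: "c \<in> A \<Longrightarrow> p \<in> B \<Longrightarrow> (\<lambda>\<omega> x. c \<omega> * p x) \<in> separable A B"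
  using separable_step[OF _ _ separable_zero] by fastforce

lemma separable_add:
  "G \<in> separable A B \<Longrightarrow> H \<in> separable A B \<Longrightarrow> (\<lambda>\<omega> x. G \<omega> x + H \<omega> x) \<in> separable A B"
proof (induction rule: separable.induct)
  case (separable_step c p G)
  from separable.separable_step[OF separable_step.hyps(1,2) separable_step.IH[OF separable_step.prems]]
  show ?case by (simp add: add.assoc)
qed simp

lemma separable_sum:
  "(\<And>i. i \<in> I \<Longrightarrow> G i \<in> separable A B) \<Longrightarrow> (\<lambda>\<omega> x. \<Sum>i\<in>I. G i \<omega> x) \<in> separable A B"
  by (induction I rule: infinite_finite_induct) (auto intro: separable_zero separable_add)

lemma separable_mult:
  assumes A: "\<And>c d. c \<in> A \<Longrightarrow> d \<in> A \<Longrightarrow> (\<lambda>\<omega>. c \<omega> * d \<omega>) \<in> A"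
    and B: "\<And>p q. p \<in> B \<Longrightarrow> q \<in> B \<Longrightarrow> (\<lambda>x. p x * q x) \<in> B"
    and H: "H \<in> separable A B"
  shows "G \<in> separable A B \<Longrightarrow> (\<lambda>\<omega> x. G \<omega> x * H \<omega> x) \<in> separable A B"
proof (induction rule: separable.induct)
  case (separable_step c p G)
  from H have "(\<lambda>\<omega> x. (c \<omega> * p x) * H \<omega> x) \<in> separable A B"
  proof (induction rule: separable.induct)
    case (separable_step d q K)
    from separable.separable_step[OF A[OF \<open>c \<in> A\<close> separable_step.hyps(1)] B[OF \<open>p \<in> B\<close> separable_step.hyps(2)] separable_step.IH]
    show ?case by (simp add: algebra_simps)
  qed (simp add: separable.separable_zero)
  from separable_add[OF this separable_step.IH] show ?case by (simp add: algebra_simps)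
qed (simp add: separable.separable_zero)

section \<open>The jump process and its random series\<close>

context dunkl
begin

text \<open>An integer is used in place of \<open>sum k Rp\<close> to keep the density of \<^const>\<open>scale_measure\<close> polynomial;
  the excess is the rate of a jump by \<open>root_refl 0 = id\<close>, which changes nothing.\<close>

definition N :: nat where "N = nat \<lceil>sum k Rp\<rceil> + 1"

lemma N_pos: "N > 0" and N_ge: "sum k Rp \<le> real N"
  by (auto simp: N_def) linarith

definition weight :: "'a \<Rightarrow> real" where
  "weight \<alpha> = (if \<alpha> = 0 then real N - sum k Rp else if \<alpha> \<in> Rp then k \<alpha> else 0)"

lemma zero_notin_Rp: "0 \<notin> Rp"
  using root_nonzero by blast

lemma weight_nonneg: "weight \<alpha> \<ge> 0"
  using N_ge k_nonneg by (auto simp: weight_def)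

lemma sum_weight: "(\<Sum>\<alpha>\<in>insert 0 Rp. of_real (weight \<alpha>) * h \<alpha>)
    = of_real (real N - sum k Rp) * h 0 + (\<Sum>\<alpha>\<in>Rp. of_real (k \<alpha>) * (h \<alpha> :: 'b::real_algebra_1))"
proof -
  have "(\<Sum>\<alpha>\<in>Rp. of_real (weight \<alpha>) * h \<alpha>) = (\<Sum>\<alpha>\<in>Rp. of_real (k \<alpha>) * h \<alpha>)"
    using zero_notin_Rp by (intro sum.cong refl) (auto simp: weight_def)
  then show ?thesis
    using finite_Rp zero_notin_Rp by (simp add: weight_def)
qed

definition jump :: "'a pmf" where "jump = embed_pmf (\<lambda>\<alpha>. weight \<alpha> / real N)"

lemma pmf_jump: "pmf jump \<alpha> = weight \<alpha> / real N"
  unfolding jump_def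
proof (rule pmf_embed_pmf)
  have "(\<integral>\<^sup>+\<alpha>. ennreal (weight \<alpha> / real N) \<partial>count_space UNIV) = (\<Sum>\<alpha>\<in>insert 0 Rp. ennreal (weight \<alpha> / real N))"
    using finite_Rp by (intro nn_integral_count_space') (auto simp: weight_def)
  also have "\<dots> = ennreal (\<Sum>\<alpha>\<in>insert 0 Rp. weight \<alpha> / real N)"
    using weight_nonneg by (intro sum_ennreal) auto
  also have "(\<Sum>\<alpha>\<in>insert 0 Rp. weight \<alpha> / real N) = 1"
    using sum_weight[of "\<lambda>_. 1::real"] N_pos by (simp flip: sum_divide_distrib)
  finally show "(\<integral>\<^sup>+\<alpha>. ennreal (weight \<alpha> / real N) \<partial>count_space UNIV) = 1" by simp
qed (use weight_nonneg in auto)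

lemma integral_jump:
  fixes h :: "'a \<Rightarrow> complex"
  shows "(\<integral>\<alpha>. of_nat N * h \<alpha> \<partial>measure_pmf jump) = (\<Sum>\<alpha>\<in>insert 0 Rp. of_real (weight \<alpha>) * h \<alpha>)"
proof -
  have "(\<integral>\<alpha>. of_nat N * h \<alpha> \<partial>measure_pmf jump)
    = (\<Sum>\<alpha>\<in>insert 0 Rp. pmf jump \<alpha> *\<^sub>R (of_nat N * h \<alpha>))"
    using finite_Rp by (intro integral_measure_pmf) (auto simp: set_pmf_iff pmf_jump weight_def split: if_splits)
  then show ?thesis
    using N_pos by (simp add: pmf_jump scaleR_conv_of_real)
qed

definition step :: "(real \<times> 'a) measure" where
  "step = scale_measure N \<Otimes>\<^sub>M measure_pmf jump"

abbreviation \<Omega> :: "(real \<times> 'a) stream measure" where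
  "\<Omega> \<equiv> stream_space step"

sublocale scale: prob_space "scale_measure N"
  by (rule prob_space_scale_measure[OF N_pos])

sublocale scale_jump: pair_prob_space "scale_measure N" "measure_pmf jump" ..

sublocale step: prob_space step
  unfolding step_def by (rule scale_jump.P.prob_space_axioms)

sublocale \<Omega>: prob_space \<Omega>
  by (rule step.prob_space_stream_space)

lemma space_step [simp]: "space step = UNIV" and space_\<Omega> [simp]: "space \<Omega> = UNIV"
  by (simp_all add: space_stream_space step_def space_pair_measure)

text \<open>The first component is clamped to \<open>[0, 1]\<close> and the second to \<open>insert 0 Rp\<close>, outside of which
  \<^const>\<open>step\<close> has no mass, so that the series below converges on the whole sample space.\<close>

definition factor :: "real \<times> 'a \<Rightarrow> real" where "factor p = max 0 (min 1 (fst p))"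

definition root :: "real \<times> 'a \<Rightarrow> 'a" where "root p = (if snd p \<in> Rp then snd p else 0)"

lemma factor_bounds [simp]: "0 \<le> factor p" "factor p \<le> 1"
  by (auto simp: factor_def)

text \<open>Unfolded, term n is \<open>s_0 ... s_(n-1) (1 - s_n)\<close> times the image of x under
  the first n reflections, the head of the stream acting first: the part of the path integral
  between two successive jumps.\<close>

primrec rterm :: "nat \<Rightarrow> (real \<times> 'a) stream \<Rightarrow> 'a \<Rightarrow> 'a" where
  "rterm 0 = (\<lambda>\<omega> x. (1 - factor (shd \<omega>)) *\<^sub>R x)"
| "rterm (Suc n) = (\<lambda>\<omega> x. factor (shd \<omega>) *\<^sub>R rterm n (stl \<omega>) (root_refl (root (shd \<omega>)) x))"

text \<open>The partial products of the factors are the successive jump times of the process \<open>W\<close>, so the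
  sum is the integral of \<open>W\<^sub>t x\<close> over \<open>t\<close>.\<close>

definition rsum :: "(real \<times> 'a) stream \<Rightarrow> 'a \<Rightarrow> 'a" where
  "rsum \<omega> x = (\<Sum>n. rterm n \<omega> x)"

text \<open>Reflections preserve the norm and the weights telescope to
  \<open>1 - s_0 ... s_(m-1)\<close>; the induction splits off the head, so \<omega> and x must
  vary.\<close>

lemma sum_norm_rterm: "(\<Sum>n<m. norm (rterm n \<omega> x)) \<le> norm x"
proof (induction m arbitrary: \<omega> x)
  case (Suc m)
  have "(\<Sum>n<Suc m. norm (rterm n \<omega> x)) = (1 - factor (shd \<omega>)) * norm x
    + factor (shd \<omega>) * (\<Sum>n<m. norm (rterm n (stl \<omega>) (root_refl (root (shd \<omega>)) x)))"
    unfolding sum.lessThan_Suc_shift by (simp add: sum_distrib_left)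
  also have "\<dots> \<le> (1 - factor (shd \<omega>)) * norm x + factor (shd \<omega>) * norm x"
    using Suc.IH[of "stl \<omega>" "root_refl (root (shd \<omega>)) x"]
    by (intro add_left_mono mult_left_mono) auto
  finally show ?case by (simp add: algebra_simps)
qed simp

lemma summable_norm_rterm: "summable (\<lambda>n. norm (rterm n \<omega> x))"
  by (rule summableI_nonneg_bounded[OF _ sum_norm_rterm]) simp

lemma summable_rterm: "summable (\<lambda>n. rterm n \<omega> x)"
  by (rule summable_norm_cancel[OF summable_norm_rterm])

lemma norm_rsum: "norm (rsum \<omega> x) \<le> norm x"
  unfolding rsum_def
  using summable_norm[OF summable_norm_rterm] suminf_le_const[OF summable_norm_rterm sum_norm_rterm]
  by (rule order_trans)

text \<open>The self-similarity of the series, from which the radial equation is derived.\<close>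

lemma rsum_Stream:
  "rsum (p ## \<omega>) x = (1 - factor p) *\<^sub>R x + factor p *\<^sub>R rsum \<omega> (root_refl (root p) x)"
  using suminf_split_head[OF summable_rterm, of "p ## \<omega>" x]
  by (simp add: rsum_def suminf_scaleR_right[OF summable_rterm])

lemma rterm_linear: "linear (rterm n \<omega>)"
proof (induction n arbitrary: \<omega>)
  case 0
  show ?case by (auto intro!: linearI simp: algebra_simps)
next
  case (Suc n)
  interpret r: linear "rterm n (stl \<omega>)" by (rule Suc)
  interpret s: bounded_linear "root_refl (root (shd \<omega>))" by (rule root_refl_linear)
  show ?case by (rule linearI) (simp_all add: r.add r.scale s.add s.scale algebra_simps)
qed

lemma rsum_linear: "linear (rsum \<omega>)"
proof (rule linearI)
  show "rsum \<omega> (x + y) = rsum \<omega> x + rsum \<omega> y" for x y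
    unfolding rsum_def linear_add[OF rterm_linear] by (intro suminf_add[symmetric] summable_rterm)
  show "rsum \<omega> (c *\<^sub>R x) = c *\<^sub>R rsum \<omega> x" for x c
    unfolding rsum_def linear_scale[OF rterm_linear] by (rule suminf_scaleR_right[OF summable_rterm, symmetric])
qed

text \<open>The weights of a partial sum add up to at most 1; the missing mass is placed at 0, hence
  the assumption \<open>0 \<in> C\<close>. Closedness takes care of the limit.\<close>

lemma rsum_in_convex:
  assumes C: "convex C" "closed C" "0 \<in> C" and inv: "\<And>\<alpha> y. \<alpha> \<in> Rp \<Longrightarrow> y \<in> C \<Longrightarrow> root_refl \<alpha> y \<in> C"
    and x: "x \<in> C"
  shows "rsum \<omega> x \<in> C"
proof -
  have "(\<Sum>n<m. rterm n \<omega> x) \<in> C" for m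
    using x
  proof (induction m arbitrary: \<omega> x)
    case (Suc m)
    have "root_refl (root (shd \<omega>)) x \<in> C" using Suc.prems inv by (auto simp: root_def)
    then have "(\<Sum>n<m. rterm n (stl \<omega>) (root_refl (root (shd \<omega>)) x)) \<in> C" by (rule Suc.IH)
    then have "(1 - factor (shd \<omega>)) *\<^sub>R x
        + factor (shd \<omega>) *\<^sub>R (\<Sum>n<m. rterm n (stl \<omega>) (root_refl (root (shd \<omega>)) x)) \<in> C"
      using C(1) Suc.prems by (intro convexD) auto
    then show ?case
      unfolding sum.lessThan_Suc_shift by (simp add: scaleR_sum_right)
  qed (use C in simp)
  then show ?thesis
    unfolding rsum_def by (rule closed_sequentially[OF C(2) _ summable_LIMSEQ[OF summable_rterm]])
qed

text \<open>Measurability is proved jointly in \<omega> and x, because the recursion replaces x by a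
  vector that depends on \<omega>.\<close>

lemma rterm_measurable: "(\<lambda>p. rterm n (fst p) (snd p)) \<in> borel_measurable (\<Omega> \<Otimes>\<^sub>M borel)"
proof (induction n)
  have 1 [measurable]: "factor \<in> borel_measurable step"
    unfolding factor_def step_def by measurable
  {
    case 0
    show ?case by simp
  next
    case (Suc n)
    note [measurable] = Suc
    have [measurable]: "(\<lambda>\<alpha>. if \<alpha> \<in> Rp then \<alpha> else 0) \<in> borel_measurable (measure_pmf jump)" by simp
    have [measurable]: "root \<in> borel_measurable step"
      unfolding root_def step_def by measurable
    have "(\<lambda>p. (stl (fst p), root_refl (root (shd (fst p))) (snd p))) \<in> \<Omega> \<Otimes>\<^sub>M borel \<rightarrow>\<^sub>M \<Omega> \<Otimes>\<^sub>M borel"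
      unfolding root_refl_def coroot_def by measurable
    from measurable_compose[OF this Suc]
    have [measurable]: "(\<lambda>p. rterm n (stl (fst p)) (root_refl (root (shd (fst p))) (snd p)))
        \<in> borel_measurable (\<Omega> \<Otimes>\<^sub>M borel)" by simp
    show ?case by simp
  }
qed

lemma rsum_measurable [measurable]: "(\<lambda>\<omega>. rsum \<omega> x) \<in> borel_measurable \<Omega>"
proof -
  have "(\<lambda>\<omega>. (\<omega>, x)) \<in> \<Omega> \<rightarrow>\<^sub>M \<Omega> \<Otimes>\<^sub>M borel" by measurable
  from measurable_compose[OF this rterm_measurable]
  have "(\<lambda>\<omega>. rterm n \<omega> x) \<in> borel_measurable \<Omega>" for n by simp
  then show ?thesis unfolding rsum_def by (rule borel_measurable_suminf)
qed

section \<open>The expectation operator\<close>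

lemma continuous_rsum_measurable:
  fixes f :: "'a \<Rightarrow> 'b::{banach, second_countable_topology}"
  assumes "continuous_on UNIV f"
  shows "(\<lambda>\<omega>. f (rsum \<omega> x)) \<in> borel_measurable \<Omega>"
  using rsum_measurable borel_measurable_continuous_onI[OF assms] by (rule measurable_compose)

lemma continuous_rsum_bounded:
  fixes f :: "'a \<Rightarrow> 'b::{banach, second_countable_topology}"
  assumes "continuous_on UNIV f"
  shows "\<exists>B. \<forall>\<omega>. norm (f (rsum \<omega> x)) \<le> B"
proof -
  have "compact (f ` cball 0 (norm x))"
    using assms by (intro compact_continuous_image) (auto intro: continuous_on_subset)
  then obtain B where "\<And>z. z \<in> f ` cball 0 (norm x) \<Longrightarrow> norm z \<le> B"
    using compact_imp_bounded bounded_iff by metis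
  then show ?thesis by (intro exI[of _ B] allI) (simp add: norm_rsum)
qed

lemma integrable_rsum:
  fixes f :: "'a \<Rightarrow> 'b::{banach, second_countable_topology}"
  assumes "continuous_on UNIV f"
  shows "integrable \<Omega> (\<lambda>\<omega>. f (rsum \<omega> x))"
proof -
  obtain B where "\<And>\<omega>. norm (f (rsum \<omega> x)) \<le> B"
    using continuous_rsum_bounded[OF assms] by blast
  then show ?thesis
    using continuous_rsum_measurable[OF assms] by (intro \<Omega>.integrable_const_bound[where B = B]) auto
qed

definition V :: "('a \<Rightarrow> complex) \<Rightarrow> 'a \<Rightarrow> complex" where
  "V f x = (\<integral>\<omega>. f (rsum \<omega> x) \<partial>\<Omega>)"

lemma V_const [simp]: "V (\<lambda>x. c) = (\<lambda>x. c)"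
  by (rule ext) (use \<Omega>.prob_space in \<open>simp add: V_def\<close>)

lemma V_add: "f \<in> polys \<Longrightarrow> g \<in> polys \<Longrightarrow> V (\<lambda>x. f x + g x) = (\<lambda>x. V f x + V g x)"
  unfolding V_def using integrable_rsum[OF polys_continuous] by auto

lemma V_diff: "f \<in> polys \<Longrightarrow> g \<in> polys \<Longrightarrow> V (\<lambda>x. f x - g x) = (\<lambda>x. V f x - V g x)"
  unfolding V_def using integrable_rsum[OF polys_continuous] by auto

lemma V_cmult: "V (\<lambda>x. c * f x) = (\<lambda>x. c * V f x)"
  unfolding V_def by simp

text \<open>The first-step analysis: \<open>V G x\<close> is computed once by linearity and once by
  integrating the first factor and the first root, where G is chosen so that the integral over the
  factor is elementary.\<close>

lemma V_radial_equation:
  assumes f: "f \<in> hom_polys n"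
  shows "of_nat n * V f x + (\<Sum>\<alpha>\<in>Rp. of_real (k \<alpha>) * (V f x - V f (root_refl \<alpha> x)))
    = V (dir_deriv x f) x"
proof -
  note fp = hom_polysD(1)[OF f]
  interpret D: linear "\<lambda>\<xi>. dir_deriv \<xi> f y" for y using fp by (rule dir_deriv_linear)
  \<comment> \<open>The direction x is fixed here. Along the segment
    \<open>p s = (1 - s) x + s \<eta>\<close> one has \<open>s p' = p - x\<close>, so Euler's
    identity turns \<open>G (p s)\<close> into \<open>N f (p s) + s (f o p)' s\<close>, the
    integrand of \<open>integral_scale_measure_FTC\<close>.\<close>
  define G where "G y = of_nat (N + n) * f y - dir_deriv x f y" for y
  have Gp: "G \<in> polys" unfolding G_def using fp by auto
  note Gc = polys_continuous[OF Gp, of UNIV]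
  have scale: "(\<integral>s. G (rsum ((s, \<alpha>) ## \<omega>) x) \<partial>scale_measure N)
      = of_nat N * f (rsum \<omega> (root_refl (root (0, \<alpha>)) x))" for \<alpha> \<omega>
  proof -
    define \<eta> where "\<eta> = rsum \<omega> (root_refl (root (0, \<alpha>)) x)"
    define p where "p s = (1 - s) *\<^sub>R x + s *\<^sub>R \<eta>" for s
    have p': "(p has_derivative (\<lambda>h. h *\<^sub>R (\<eta> - x))) (at s)" for s
      unfolding p_def by (auto intro!: derivative_eq_intros simp: algebra_simps)
    have pc: "continuous_on UNIV p" unfolding p_def by (intro continuous_intros)
    have rs: "rsum ((s, \<alpha>) ## \<omega>) x = p (max 0 (min 1 s))" for s
      \<comment> \<open>Clamping disappears on [0, 1], the only place where
        \<open>integral_scale_measure_FTC\<close> asks for an identity.\<close>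
      by (simp add: rsum_Stream factor_def root_def p_def \<eta>_def)
    have "(\<integral>s. G (rsum ((s, \<alpha>) ## \<omega>) x) \<partial>scale_measure N) = of_nat N * f (p 1)"
      unfolding rs
    proof (rule integral_scale_measure_FTC[OF N_pos, where \<phi>' = "\<lambda>s. dir_deriv (\<eta> - x) f (p s)"])
      show "(\<lambda>s. G (p (max 0 (min 1 s)))) \<in> borel_measurable borel"
        by (intro borel_measurable_continuous_onI continuous_on_compose2[OF Gc]
            continuous_on_compose2[OF pc] continuous_intros) auto
      show "((\<lambda>s. f (p s)) has_vector_derivative dir_deriv (\<eta> - x) f (p s)) (at s)" for s
        using has_derivative_compose[OF p' polys_has_derivative[OF fp]]
        by (simp add: has_vector_derivative_def D.scale)
      show "continuous_on UNIV (\<lambda>s. dir_deriv (\<eta> - x) f (p s))"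
        by (rule continuous_on_compose2[OF polys_continuous[OF dir_deriv_polys[OF fp]] pc subset_UNIV])
      show "G (p (max 0 (min 1 s))) = of_nat N * f (p s) + of_real s * dir_deriv (\<eta> - x) f (p s)"
        if "0 \<le> s" "s \<le> 1" for s
      proof -
        have "of_real s * dir_deriv (\<eta> - x) f (p s) = dir_deriv (s *\<^sub>R (\<eta> - x)) f (p s)"
          by (simp add: D.scale scaleR_conv_of_real)
        also have "s *\<^sub>R (\<eta> - x) = p s - x"
          by (simp add: p_def algebra_simps)
        also have "dir_deriv (p s - x) f (p s) = of_nat n * f (p s) - dir_deriv x f (p s)"
          unfolding D.diff euler_identity[OF f] ..
        finally show ?thesis using that by (simp add: G_def algebra_simps)
      qed
    qed
    then show ?thesis by (simp add: p_def \<eta>_def)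
  qed
  have step: "(\<integral>p. G (rsum (p ## \<omega>) x) \<partial>step)
      = (\<Sum>\<alpha>\<in>insert 0 Rp. of_real (weight \<alpha>) * f (rsum \<omega> (root_refl \<alpha> x)))" for \<omega>
  proof -
    obtain B where B: "\<And>\<omega>. norm (G (rsum \<omega> x)) \<le> B"
      using continuous_rsum_bounded[OF Gc] by blast
    have [measurable]: "(\<lambda>\<omega>. G (rsum \<omega> x)) \<in> borel_measurable \<Omega>"
      by (rule continuous_rsum_measurable[OF Gc])
    have "(\<lambda>p. p ## \<omega>) \<in> step \<rightarrow>\<^sub>M \<Omega>" by measurable
    then have "(\<lambda>p. G (rsum (p ## \<omega>) x)) \<in> borel_measurable step" by measurable
    then have "integrable step (\<lambda>p. G (rsum (p ## \<omega>) x))"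
      using B by (intro step.integrable_const_bound[where B = B]) auto
    then have int: "integrable (scale_measure N \<Otimes>\<^sub>M measure_pmf jump) (\<lambda>(s, \<alpha>). G (rsum ((s, \<alpha>) ## \<omega>) x))"
      by (simp add: step_def case_prod_unfold)
    have "(\<integral>p. G (rsum (p ## \<omega>) x) \<partial>step)
      = (\<integral>p. (case p of (s, \<alpha>) \<Rightarrow> G (rsum ((s, \<alpha>) ## \<omega>) x)) \<partial>(scale_measure N \<Otimes>\<^sub>M measure_pmf jump))"
      by (simp add: step_def case_prod_unfold)
    also have "\<dots> = (\<integral>\<alpha>. \<integral>s. G (rsum ((s, \<alpha>) ## \<omega>) x) \<partial>scale_measure N \<partial>measure_pmf jump)"
      by (rule scale_jump.integral_snd[OF int, symmetric])
    also have "\<dots> = (\<Sum>\<alpha>\<in>insert 0 Rp. of_real (weight \<alpha>) * f (rsum \<omega> (root_refl (root (0, \<alpha>)) x)))"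
      unfolding scale by (rule integral_jump)
    also have "\<dots> = (\<Sum>\<alpha>\<in>insert 0 Rp. of_real (weight \<alpha>) * f (rsum \<omega> (root_refl \<alpha> x)))"
      by (intro sum.cong refl) (auto simp: root_def)
    finally show ?thesis .
  qed
  have "V G x = (\<integral>\<omega>. \<integral>p. G (rsum (p ## \<omega>) x) \<partial>step \<partial>\<Omega>)"
    unfolding V_def by (rule step.integral_stream_space[OF integrable_rsum[OF Gc]])
  also have "\<dots> = (\<Sum>\<alpha>\<in>insert 0 Rp. of_real (weight \<alpha>) * V f (root_refl \<alpha> x))"
    unfolding step V_def using integrable_rsum[OF polys_continuous[OF fp]] by simp
  \<comment> \<open>The null jump at root 0 contributes \<open>V f x\<close> itself, so the N here
    cancels the N in G and only the true rates remain.\<close>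
  also have "\<dots> = of_real (real N - sum k Rp) * V f x + (\<Sum>\<alpha>\<in>Rp. of_real (k \<alpha>) * V f (root_refl \<alpha> x))"
    unfolding sum_weight by simp
  finally have "V G x = of_real (real N - sum k Rp) * V f x + (\<Sum>\<alpha>\<in>Rp. of_real (k \<alpha>) * V f (root_refl \<alpha> x))" .
  moreover have "V G x = of_nat (N + n) * V f x - V (dir_deriv x f) x"
    unfolding G_def using fp by (subst V_diff) (auto simp: V_cmult)
  ultimately show ?thesis
    by (simp add: algebra_simps sum_subtractf sum_distrib_left sum_distrib_right)
qed

text \<open>Since \<open>rsum \<omega>\<close> is linear, \<open>f (rsum \<omega> x)\<close> is
  polynomial in x with random coefficients; taking expectations of these leaves a
  polynomial.\<close>

lemma V_polys:
  assumes "f \<in> polys"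
  shows "V f \<in> polys"
proof -
  \<comment> \<open>Boundedness, rather than mere integrability, is what makes the coefficients
    closed under products.\<close>
  define bm where "bm = {c :: _ \<Rightarrow> complex. c \<in> borel_measurable \<Omega> \<and> (\<exists>B. \<forall>\<omega>. norm (c \<omega>) \<le> B)}"
  have bm_int: "integrable \<Omega> c" if "c \<in> bm" for c
    using that by (auto simp: bm_def intro: \<Omega>.integrable_const_bound)
  have bm_mult: "(\<lambda>\<omega>. c \<omega> * d \<omega>) \<in> bm" if "c \<in> bm" "d \<in> bm" for c d
  proof -
    from that obtain B B' where "\<And>\<omega>. norm (c \<omega>) \<le> B" "\<And>\<omega>. norm (d \<omega>) \<le> B'"
      by (auto simp: bm_def)
    then have "norm (c \<omega> * d \<omega>) \<le> B * B'" for \<omega>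
      unfolding norm_mult by (meson mult_mono norm_ge_zero order_trans)
    with that show ?thesis by (auto simp: bm_def)
  qed
  have cont: "(\<lambda>\<omega>. h (rsum \<omega> x)) \<in> bm" if "continuous_on UNIV h" for h x
    using continuous_rsum_measurable[OF that] continuous_rsum_bounded[OF that] by (auto simp: bm_def)
  have "(\<lambda>\<omega> x. f (rsum \<omega> x)) \<in> separable bm polys"
    using assms
  proof (induction rule: polys_induct)
    case (const c)
    then show ?case
      using separable_single[of "\<lambda>_. c" bm "\<lambda>_. 1" polys] by (auto simp: bm_def)
  next
    case (inner v)
    have expand: "rsum \<omega> x \<bullet> v = (\<Sum>b\<in>Basis. (rsum \<omega> b \<bullet> v) * (x \<bullet> b))" for \<omega> x
    proof -
      have "rsum \<omega> x = rsum \<omega> (\<Sum>b\<in>Basis. (x \<bullet> b) *\<^sub>R b)" by (simp add: euclidean_representation)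
      also have "\<dots> = (\<Sum>b\<in>Basis. (x \<bullet> b) *\<^sub>R rsum \<omega> b)"
        unfolding linear_sum[OF rsum_linear] linear_scale[OF rsum_linear] ..
      finally show ?thesis by (simp add: inner_sum_left mult.commute)
    qed
    have eq: "(\<lambda>\<omega> x. complex_of_real (rsum \<omega> x \<bullet> v))
        = (\<lambda>\<omega> x. \<Sum>b\<in>Basis. of_real (rsum \<omega> b \<bullet> v) * of_real (x \<bullet> b))"
      by (intro ext, subst expand) simp
    show ?case
      unfolding eq
    proof (rule separable_sum)
      fix b :: 'a
      have "continuous_on UNIV (\<lambda>y::'a. complex_of_real (y \<bullet> v))"
        by (rule polys_continuous[OF polys_inner])
      from separable_single[OF cont[OF this] polys_inner]
      show "(\<lambda>\<omega> x. complex_of_real (rsum \<omega> b \<bullet> v) * of_real (x \<bullet> b)) \<in> separable bm polys" .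
    qed
  next
    case (add f g)
    show ?case by (rule separable_add[OF add.IH])
  next
    case (mult f g)
    show ?case by (rule separable_mult[OF bm_mult polys_mult mult.IH(2,1)])
  qed
  then have "(\<forall>x. integrable \<Omega> (\<lambda>\<omega>. f (rsum \<omega> x))) \<and> (\<lambda>x. \<integral>\<omega>. f (rsum \<omega> x) \<partial>\<Omega>) \<in> polys"
    by (induction rule: separable.induct) (auto simp: bm_int)
  then show ?thesis by (simp add: V_def[abs_def])
qed

end

section \<open>The intertwining operator\<close>

text \<open>A degree bound for inhomogeneous polynomials in terms of derivatives, shaped for the
  induction in \<open>V_eq_zero\<close>.\<close>

primrec deriv_nil :: "nat \<Rightarrow> ('a::euclidean_space \<Rightarrow> complex) \<Rightarrow> bool" where
  "deriv_nil 0 f \<longleftrightarrow> f = (\<lambda>x. 0)"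
| "deriv_nil (Suc m) f \<longleftrightarrow> (\<forall>\<xi>. deriv_nil m (dir_deriv \<xi> f))"

lemma deriv_nil_Suc: "deriv_nil m f \<Longrightarrow> deriv_nil (Suc m) f"
  by (induction m arbitrary: f) auto

lemma deriv_nil_mono: "m \<le> n \<Longrightarrow> deriv_nil m f \<Longrightarrow> deriv_nil n f"
  by (induction n rule: dec_induct) (auto intro: deriv_nil_Suc simp del: deriv_nil.simps)

lemma deriv_nil_add:
  "f \<in> polys \<Longrightarrow> g \<in> polys \<Longrightarrow> deriv_nil m f \<Longrightarrow> deriv_nil m g \<Longrightarrow> deriv_nil m (\<lambda>x. f x + g x)"
  by (induction m arbitrary: f g) auto

lemma hom_polys_deriv_nil: "f \<in> hom_polys n \<Longrightarrow> deriv_nil (Suc n) f"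
proof (induction n arbitrary: f)
  case 0
  then show ?case by (auto simp: hom_polys_0)
next
  case (Suc n)
  then show ?case using hom_polys_dir_deriv[of f "Suc n"] by simp
qed

lemma polys_deriv_nil: "f \<in> polys \<Longrightarrow> \<exists>m. deriv_nil m f"
proof (induction rule: polys_hom_induct)
  case (hom n f)
  then show ?case using hom_polys_deriv_nil by blast
next
  case (add f g)
  then obtain m n where "deriv_nil m f" "deriv_nil n g" by blast
  then have "deriv_nil (max m n) f" "deriv_nil (max m n) g"
    using deriv_nil_mono by (metis max.cobounded1, metis max.cobounded2)
  then show ?case using deriv_nil_add add by blast
qed

section \<open>The intertwining relation and bijectivity\<close>

context dunkl
begin

lemma V_hom:
  assumes "f \<in> hom_polys n"
  shows "V f \<in> hom_polys n"
proof -
  have "V f (c *\<^sub>R x) = of_real (c ^ n) * V f x" for c x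
    unfolding V_def linear_scale[OF rsum_linear] hom_polysD(2)[OF assms] by simp
  then show ?thesis
    using V_polys[OF hom_polysD(1)[OF assms]] by (simp add: hom_polys_def)
qed

lemma V_dir_deriv_linear:
  assumes f: "f \<in> polys"
  shows "linear (\<lambda>\<xi>. V (dir_deriv \<xi> f) x)"
proof (rule linearI)
  have "dir_deriv (\<xi> + \<eta>) f = (\<lambda>x. dir_deriv \<xi> f x + dir_deriv \<eta> f x)" for \<xi> \<eta>
    using linear_add[OF dir_deriv_linear[OF f]] by (intro ext)
  then show "V (dir_deriv (\<xi> + \<eta>) f) x = V (dir_deriv \<xi> f) x + V (dir_deriv \<eta> f) x" for \<xi> \<eta>
    using f by (simp add: V_add)
  have "dir_deriv (c *\<^sub>R \<xi>) f = (\<lambda>x. of_real c * dir_deriv \<xi> f x)" for c \<xi>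
    using linear_scale[OF dir_deriv_linear[OF f]] by (intro ext) (simp add: scaleR_conv_of_real)
  then show "V (dir_deriv (c *\<^sub>R \<xi>) f) x = c *\<^sub>R V (dir_deriv \<xi> f) x" for c \<xi>
    using f by (simp add: V_cmult scaleR_conv_of_real)
qed

text \<open>Induction on the degree: the hypothesis applied to the derivatives of f, with the
  symmetry of second derivatives, makes the family \<open>V (dir_deriv \<xi> f)\<close> compatible.
  \<open>T_eq_if_radial_equation\<close> then lifts the radial equation to all directions.\<close>

lemma T_V_hom: "f \<in> hom_polys n \<Longrightarrow> T \<xi> (V f) = V (dir_deriv \<xi> f)"
proof (induction n arbitrary: f \<xi>)
  case 0
  then show ?case by (auto simp: hom_polys_0)
next
  case (Suc n)
  note fp = hom_polysD(1)[OF Suc.prems]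
  have d: "dir_deriv \<xi> f \<in> hom_polys n" for \<xi>
    using hom_polys_dir_deriv[OF Suc.prems] by simp
  show ?case
  proof
    fix x
    show "T \<xi> (V f) x = V (dir_deriv \<xi> f) x"
    proof (rule T_eq_if_radial_equation[OF V_hom[OF Suc.prems]])
      show "V (dir_deriv \<eta> f) \<in> hom_polys (Suc n - 1)" for \<eta> using V_hom[OF d] by simp
      show "linear (\<lambda>\<xi>. V (dir_deriv \<xi> f) x)" for x using fp by (rule V_dir_deriv_linear)
      show "T \<eta> (V (dir_deriv \<zeta> f)) = T \<zeta> (V (dir_deriv \<eta> f))" for \<eta> \<zeta>
        unfolding Suc.IH[OF d] dir_deriv_commute[OF fp, of \<eta>] ..
    qed (use V_radial_equation[OF Suc.prems] in auto)
  qed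
qed

lemma T_V: "f \<in> polys \<Longrightarrow> T \<xi> (V f) = V (dir_deriv \<xi> f)"
proof (induction rule: polys_hom_induct)
  case (hom n f)
  then show ?case by (rule T_V_hom)
next
  case (add f g)
  then show ?case by (simp add: V_add T_add V_polys)
qed

text \<open>If \<open>V f = 0\<close>, then \<open>V\<close> kills every
  \<open>dir_deriv \<xi> f\<close> by \<open>T_V\<close>. By induction these vanish, so f is
  constant, and \<open>V\<close> fixes constants.\<close>

lemma V_eq_zero: "deriv_nil m f \<Longrightarrow> f \<in> polys \<Longrightarrow> V f = (\<lambda>x. 0) \<Longrightarrow> f = (\<lambda>x. 0)"
proof (induction m arbitrary: f)
  case (Suc m)
  have "dir_deriv \<xi> f = (\<lambda>x. 0)" for \<xi>
  proof (rule Suc.IH)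
    show "V (dir_deriv \<xi> f) = (\<lambda>x. 0)"
      using T_V[OF Suc.prems(2), of \<xi>] Suc.prems(3) by simp
  qed (use Suc.prems in auto)
  then obtain c where f: "f = (\<lambda>x. c)"
    using const_if_dir_deriv_zero[OF Suc.prems(2)] by blast
  with Suc.prems(3) show ?case by (simp add: fun_eq_iff)
qed simp

lemma V_inj:
  assumes "f \<in> polys" "g \<in> polys" "V f = V g"
  shows "f = g"
proof -
  have p: "(\<lambda>x. f x - g x) \<in> polys" using assms by blast
  have "V (\<lambda>x. f x - g x) = (\<lambda>x. 0)" using assms by (simp add: V_diff)
  with p have "(\<lambda>x. f x - g x) = (\<lambda>x. 0)"
    using polys_deriv_nil V_eq_zero by blast
  then show ?thesis by (simp add: fun_eq_iff)
qed

text \<open>The preimages \<open>F \<xi>\<close> of \<open>T \<xi> g\<close> exist by induction.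
  Injectivity makes them linear in \<xi> and, as Dunkl operators commute, closed; so they are the
  derivatives of some f. Then all \<open>T \<xi>\<close> annihilate \<open>V f - g\<close>.\<close>

lemma V_surj_hom: "g \<in> hom_polys n \<Longrightarrow> \<exists>f\<in>hom_polys n. V f = g"
proof (induction n arbitrary: g)
  case 0
  then show ?case by (auto simp: hom_polys_0 intro!: bexI[of _ g])
next
  case (Suc m)
  note gp = hom_polysD(1)[OF Suc.prems]
  have "\<exists>f\<in>hom_polys m. V f = T \<xi> g" for \<xi>
    using Suc.IH[of "T \<xi> g"] T_hom[OF Suc.prems, of \<xi>] by simp
  then obtain F where F: "\<And>\<xi>. F \<xi> \<in> hom_polys m" "\<And>\<xi>. V (F \<xi>) = T \<xi> g" by metis
  note Fp = hom_polysD(1)[OF F(1)]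
  have F_lin: "linear (\<lambda>\<xi>. F \<xi> x)" for x
  proof (rule linearI)
    have "F (\<xi> + \<eta>) = (\<lambda>x. F \<xi> x + F \<eta> x)" for \<xi> \<eta>
      by (rule V_inj) (use Fp linear_add[OF T_linear[OF gp]] in \<open>auto simp: V_add F\<close>)
    then show "F (\<xi> + \<eta>) x = F \<xi> x + F \<eta> x" for \<xi> \<eta> by metis
    have "F (c *\<^sub>R \<xi>) = (\<lambda>x. of_real c * F \<xi> x)" for c \<xi>
      by (rule V_inj) (use Fp linear_scale[OF T_linear[OF gp]] in \<open>auto simp: V_cmult F scaleR_conv_of_real\<close>)
    then show "F (c *\<^sub>R \<xi>) x = c *\<^sub>R F \<xi> x" for c \<xi> by (metis scaleR_conv_of_real)
  qed
  have F_sym: "dir_deriv \<xi> (F \<eta>) = dir_deriv \<eta> (F \<xi>)" for \<xi> \<eta>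
    by (rule V_inj) (use Fp in \<open>auto simp: F T_commute[OF gp, of \<xi>] simp flip: T_V\<close>)
  \<comment> \<open>By Euler's identity an f of degree \<open>Suc m\<close> with derivatives
    \<open>F \<xi>\<close> must satisfy \<open>of_nat (Suc m) * f x = F x x\<close>; expanding the
    direction x in the basis gives the formula.\<close>
  define e :: complex where "e = 1 / of_nat (Suc m)"
  define f where "f x = e * (\<Sum>b\<in>Basis. of_real (x \<bullet> b) * F b x)" for x
  have f_hom: "f \<in> hom_polys (Suc m)"
    unfolding f_def using hom_polys_mult[OF hom_polys_inner F(1)]
    by (intro hom_polys_cmult hom_polys_sum) simp
  have df: "dir_deriv \<xi> f = F \<xi>" for \<xi>
  proof
    fix x
    have "dir_deriv \<xi> f x = e *
        ((\<Sum>b\<in>Basis. of_real (x \<bullet> b) * dir_deriv b (F \<xi>) x) + (\<Sum>b\<in>Basis. of_real (\<xi> \<bullet> b) * F b x))"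
      unfolding f_def using Fp
      by (simp add: dir_deriv_sum polys_sum F_sym[of \<xi>] sum.distrib)
    also have "\<dots> = e * (dir_deriv x (F \<xi>) x + F \<xi> x)"
      using linear_expand_Basis[OF dir_deriv_linear[OF Fp], of x \<xi> x]
        linear_expand_Basis[OF F_lin, of \<xi> x] by simp
    also have "\<dots> = F \<xi> x"
    proof -
      have "dir_deriv x (F \<xi>) x + F \<xi> x = of_nat (Suc m) * F \<xi> x"
        unfolding euler_identity[OF F(1)] by (simp add: algebra_simps)
      then show ?thesis by (simp add: e_def del: of_nat_Suc)
    qed
    finally show "dir_deriv \<xi> f x = F \<xi> x" .
  qed
  have "(\<lambda>x. V f x - g x) = (\<lambda>x. 0)"
  proof (rule eq_zero_if_T_zero[OF hom_polys_diff[OF V_hom[OF f_hom] Suc.prems]])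
    show "T \<xi> (\<lambda>x. V f x - g x) = (\<lambda>x. 0)" for \<xi>
      using T_diff[OF V_polys[OF hom_polysD(1)[OF f_hom]] gp] T_V_hom[OF f_hom] by (simp add: df F)
  qed simp
  then have "V f = g" by (simp add: fun_eq_iff)
  with f_hom show ?case by blast
qed

lemma V_surj: "g \<in> polys \<Longrightarrow> \<exists>f\<in>polys. V f = g"
proof (induction rule: polys_hom_induct)
  case (hom n f)
  then show ?case using V_surj_hom hom_polysD(1) by blast
next
  case (add f g)
  then obtain f' g' where "f' \<in> polys" "V f' = f" "g' \<in> polys" "V g' = g" by blast
  then show ?case by (intro bexI[of _ "\<lambda>x. f' x + g' x"]) (auto simp: V_add)
qed

lemma V_is_intertwiner: "is_intertwiner Rp k (restrict V polys)"
  unfolding is_intertwiner_def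
proof (intro conjI ballI allI)
  have "bij_betw V polys polys"
    unfolding bij_betw_def using V_inj V_polys V_surj by (auto intro!: inj_onI) (metis imageI)
  then show "bij_betw (restrict V polys) polys polys"
    by (simp add: bij_betw_restrict_eq)
  show "restrict V polys ` hom_polys n = hom_polys n" for n
    using V_hom V_surj_hom hom_polysD(1) by (force simp: image_iff)
qed (auto simp: V_add V_cmult T_V)

section \<open>Uniqueness of the intertwining operator\<close>

lemma intertwiner_unique:
  assumes V': "is_intertwiner Rp k V'" and f: "f \<in> polys"
  shows "V' f = V f"
  using f
proof (induction rule: polys_hom_induct)
  case (hom n f)
  then show ?case
  proof (induction n arbitrary: f)
    case 0
    \<comment> \<open>The constant is written as \<open>c * 1\<close> because the axioms prescribe
      \<open>V'\<close> at 1 and its behaviour under scalars.\<close>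
    then obtain c where "f = (\<lambda>x. c * 1)" by (auto simp: hom_polys_0)
    moreover have "V' (\<lambda>x. c * 1) = (\<lambda>x. c * V' (\<lambda>x. 1) x)"
      using V' unfolding is_intertwiner_def by (elim conjE) (drule spec, erule bspec, rule polys_const)
    moreover have "V' (\<lambda>x. 1) = (\<lambda>x. 1)"
      using V' unfolding is_intertwiner_def by blast
    ultimately show ?case by simp
  next
    case (Suc n)
    note fp = hom_polysD(1)[OF Suc.prems]
    have V'f: "V' f \<in> hom_polys (Suc n)"
      using V' Suc.prems unfolding is_intertwiner_def by blast
    have "(\<lambda>x. V' f x - V f x) = (\<lambda>x. 0)"
    \<comment> \<open>Both operators carry \<open>dir_deriv \<xi>\<close> to \<open>T \<xi>\<close>
      and agree in lower degree, so every \<open>T \<xi>\<close> annihilates the difference.\<close>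
    proof (rule eq_zero_if_T_zero[OF hom_polys_diff[OF V'f V_hom[OF Suc.prems]]])
      fix \<xi>
      have "T \<xi> (V' f) = V' (dir_deriv \<xi> f)"
        using V' fp unfolding is_intertwiner_def by blast
      also have "\<dots> = V (dir_deriv \<xi> f)"
        using hom_polys_dir_deriv[OF Suc.prems] by (intro Suc.IH) simp
      finally show "T \<xi> (\<lambda>x. V' f x - V f x) = (\<lambda>x. 0)"
        by (simp add: T_diff[OF hom_polysD(1)[OF V'f] V_polys[OF fp]] T_V[OF fp])
    qed simp
    then show ?case by (simp add: fun_eq_iff)
  qed
next
  case (add f g)
  then have "V' (\<lambda>x. f x + g x) = (\<lambda>x. V' f x + V' g x)"
    using V' unfolding is_intertwiner_def by blast
  with add show ?case by (simp add: V_add)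
qed

lemma intertwiner_eq: "f \<in> polys \<Longrightarrow> intertwiner Rp k f = V f"
proof -
  have "intertwiner Rp k = restrict V polys"
    unfolding intertwiner_def
  proof (rule the_equality)
    fix V' assume "V' \<in> extensional polys \<and> is_intertwiner Rp k V'"
    then show "V' = restrict V polys"
      by (intro extensionalityI[of _ polys]) (auto simp: intertwiner_unique)
  qed (simp add: V_is_intertwiner)
  then show "f \<in> polys \<Longrightarrow> intertwiner Rp k f = V f" by simp
qed

end

section \<open>Homogeneous expansions\<close>

text \<open>Once the lower coefficients are known to vanish, divide by \<open>t ^ n\<close> and let
  t tend to 0.\<close>

lemma powser_real_zero:
  fixes a :: "nat \<Rightarrow> real"
  assumes s: "s > 0" and 0: "\<And>t. \<bar>t\<bar> < s \<Longrightarrow> (\<lambda>n. a n * t ^ n) sums 0"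
  shows "a n = 0"
proof (induction n rule: less_induct)
  case (less n)
  have "((\<lambda>t::real. 0) \<longlongrightarrow> a (0 + n)) (at (0::real))"
  proof (rule powser_limit_0_strong[OF s])
    fix t :: real assume t: "t \<noteq> 0" "norm t < s"
    have "(\<lambda>i. a (i + n) * t ^ (i + n)) sums 0"
      using 0[of t] t less by (subst sums_iff_shift) simp
    then have "(\<lambda>i. (a (i + n) * t ^ (i + n)) / t ^ n) sums (0 / t ^ n)"
      by (rule sums_divide)
    with t show "(\<lambda>i. a (i + n) * t ^ i) sums 0"
      by (simp add: power_add)
  qed
  then show ?case by (simp add: tendsto_const_iff)
qed

text \<open>On a ray through x the expansion becomes a power series in the real variable t with
  coefficients \<open>F n x\<close>. Real and imaginary parts are treated separately, and
  homogeneity extends the result from the ball to all x.\<close>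

lemma A_expansion_unique:
  assumes r: "r > 0" and F: "A_expansion r f F" and G: "A_expansion r f G"
  shows "F = G"
proof -
  have hom: "F n \<in> hom_polys n" "G n \<in> hom_polys n" for n
    using F G by (auto simp: A_expansion_def)
  have eq: "F n x = G n x" if x: "norm x \<le> r" for n x
  proof -
    have 0: "(\<lambda>n. (F n x - G n x) * of_real (t ^ n)) sums 0" if t: "\<bar>t\<bar> < 1" for t
    proof -
      have "norm (t *\<^sub>R x) \<le> r"
        using t x r by (simp add: mult_le_one mult_mono order_trans[OF mult_left_le_one_le])
      then have "(\<lambda>n. F n (t *\<^sub>R x)) sums f (t *\<^sub>R x)" "(\<lambda>n. G n (t *\<^sub>R x)) sums f (t *\<^sub>R x)"
        using F G by (auto simp: A_expansion_def)
      from sums_diff[OF this] show ?thesis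
        by (simp add: hom_polysD(2)[OF hom(1)] hom_polysD(2)[OF hom(2)] algebra_simps)
    qed
    have "Re (F n x - G n x) = 0"
      using sums_Re[OF 0] by (intro powser_real_zero[of 1 "\<lambda>n. Re (F n x - G n x)"]) (simp_all flip: of_real_power)
    moreover have "Im (F n x - G n x) = 0"
      using sums_Im[OF 0] by (intro powser_real_zero[of 1 "\<lambda>n. Im (F n x - G n x)"]) (simp_all flip: of_real_power)
    ultimately show ?thesis by (simp add: complex_eq_iff)
  qed
  have "F n x = G n x" for n x
  proof -
    \<comment> \<open>A positive factor that moves an arbitrary x into the ball; the denominator is
      positive even for \<open>x = 0\<close>.\<close>
    define c where "c = r / (norm x + r)"
    have "norm x + r > 0" using r by (simp add: add_nonneg_pos)
    then have c: "c > 0" "norm (c *\<^sub>R x) \<le> r"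
      using r by (auto simp: c_def divide_simps mult_left_mono)
    have "of_real (c ^ n) * F n x = of_real (c ^ n) * G n x"
      using eq[OF c(2), of n] by (simp add: hom_polysD(2)[OF hom(1)] hom_polysD(2)[OF hom(2)])
    with c(1) show ?thesis by simp
  qed
  then show ?thesis by (intro ext)
qed

section \<open>The homogeneous expansion of the exponential\<close>

lemma cpair_eq: "cpair \<xi> z = of_real (\<xi> \<bullet> fst z) + \<i> * of_real (\<xi> \<bullet> snd z)"
  by (simp add: cpair_def complex_eq_iff)

lemma cpair_hom: "(\<lambda>y. cpair y z) \<in> hom_polys 1"
  unfolding cpair_eq by (intro hom_polys_add hom_polys_cmult hom_polys_inner)

lemma cpair_continuous: "continuous_on UNIV (\<lambda>y. cpair y z)"
  by (rule polys_continuous[OF hom_polysD(1)[OF cpair_hom]])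

lemma norm_cpair: "norm (cpair y z) \<le> norm y * (norm (fst z) + norm (snd z))"
proof -
  have "norm (cpair y z) \<le> \<bar>y \<bullet> fst z\<bar> + \<bar>y \<bullet> snd z\<bar>"
    unfolding cpair_eq by (rule order_trans[OF norm_triangle_ineq]) (simp add: norm_mult)
  also have "\<dots> \<le> norm y * norm (fst z) + norm y * norm (snd z)"
    by (intro add_mono Cauchy_Schwarz_ineq2)
  finally show ?thesis by (simp add: distrib_left)
qed

definition exp_term :: "'a \<times> 'a \<Rightarrow> nat \<Rightarrow> 'a::euclidean_space \<Rightarrow> complex" where
  "exp_term z n y = of_real (1 / fact n) * cpair y z ^ n"

lemma exp_term_hom: "exp_term z n \<in> hom_polys n"
  unfolding exp_term_def by (intro hom_polys_cmult hom_polys_power cpair_hom)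

lemma exp_term_sums: "(\<lambda>n. exp_term z n y) sums exp (cpair y z)"
  using exp_converges[of "cpair y z"] by (simp add: exp_term_def scaleR_conv_of_real divide_inverse)

lemma norm_exp_term:
  assumes "norm y \<le> r"
  shows "norm (exp_term z n y) \<le> (r * (norm (fst z) + norm (snd z))) ^ n / fact n"
proof -
  have "norm (cpair y z) \<le> r * (norm (fst z) + norm (snd z))"
    using norm_cpair assms by (rule order_trans[OF _ mult_right_mono]) auto
  then show ?thesis
    by (simp add: exp_term_def norm_mult norm_power norm_divide divide_right_mono power_mono)
qed

lemma summable_exp_bound: "summable (\<lambda>n. c ^ n / fact n :: real)"
  using summable_exp[of c] by (simp add: divide_inverse mult.commute)

lemma A_expansion_exp:
  assumes r: "r > 0"
  shows "A_expansion r (\<lambda>y. exp (cpair y z)) (exp_term z)"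
  unfolding A_expansion_def
proof (intro conjI allI ballI)
  let ?c = "r * (norm (fst z) + norm (snd z))"
  show "summable (\<lambda>n. SUP x\<in>cball 0 r. norm (exp_term z n x))"
  proof (rule summable_comparison_test'[OF summable_exp_bound[of ?c], of 0])
    fix n
    have bound: "norm (exp_term z n x) \<le> ?c ^ n / fact n" if "x \<in> cball 0 r" for x
      using that by (intro norm_exp_term) simp
    have "0 \<in> cball (0::'a) r" using r by simp
    then have "norm (exp_term z n 0) \<le> (SUP x\<in>cball 0 r. norm (exp_term z n x))"
      using bound by (intro cSUP_upper bdd_aboveI2)
    moreover have "(SUP x\<in>cball 0 r. norm (exp_term z n x)) \<le> ?c ^ n / fact n"
      using bound r by (intro cSUP_least) auto
    ultimately show "norm (SUP x\<in>cball 0 r. norm (exp_term z n x)) \<le> ?c ^ n / fact n"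
      using norm_ge_zero[of "exp_term z n 0"] unfolding real_norm_def by linarith
  qed
qed (auto simp: exp_term_hom exp_term_sums)

context dunkl
begin

text \<open>\<open>V\<close> acts on each degree of the exponential series. Sum and expectation may
  be exchanged because \<open>norm_rsum\<close> bounds the terms by a real exponential series,
  uniformly in \<omega>.\<close>

lemma dunkl_kernel_eq: "dunkl_kernel Rp k x z = (\<integral>\<omega>. exp (cpair (rsum \<omega> x) z) \<partial>\<Omega>)"
proof -
  have "norm x + 1 > 0" by (simp add: add_nonneg_pos)
  then have "(THE F. A_expansion (norm x + 1) (\<lambda>y. exp (cpair y z)) F) = exp_term z"
    using A_expansion_exp A_expansion_unique by (intro the_equality) blast+
  then have "dunkl_kernel Rp k x z = (\<Sum>n. V (exp_term z n) x)"
    by (simp add: dunkl_kernel_def intertwiner_A_def intertwiner_eq[OF hom_polysD(1)[OF exp_term_hom]])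
  also have "\<dots> = (\<integral>\<omega>. (\<Sum>n. exp_term z n (rsum \<omega> x)) \<partial>\<Omega>)"
    unfolding V_def
  proof (rule integral_suminf[symmetric])
    let ?c = "norm x * (norm (fst z) + norm (snd z))"
    have bound: "norm (exp_term z n (rsum \<omega> x)) \<le> ?c ^ n / fact n" for n \<omega>
      by (rule norm_exp_term[OF norm_rsum])
    note cont = polys_continuous[OF hom_polysD(1)[OF exp_term_hom], of UNIV]
    show "integrable \<Omega> (\<lambda>\<omega>. exp_term z n (rsum \<omega> x))" for n
      by (rule integrable_rsum[OF cont])
    show "AE \<omega> in \<Omega>. summable (\<lambda>n. norm (exp_term z n (rsum \<omega> x)))"
      by (intro AE_I2 summable_comparison_test'[OF summable_exp_bound[of ?c], of 0]) (simp add: bound)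
    show "summable (\<lambda>n. \<integral>\<omega>. norm (exp_term z n (rsum \<omega> x)) \<partial>\<Omega>)"
    proof (rule summable_comparison_test'[OF summable_exp_bound[of ?c], of 0])
      fix n
      have "(\<integral>\<omega>. norm (exp_term z n (rsum \<omega> x)) \<partial>\<Omega>) \<le> (\<integral>\<omega>. ?c ^ n / fact n \<partial>\<Omega>)"
        using bound by (intro integral_mono integrable_norm integrable_rsum[OF cont]) auto
      then show "norm (\<integral>\<omega>. norm (exp_term z n (rsum \<omega> x)) \<partial>\<Omega>) \<le> ?c ^ n / fact n"
        using \<Omega>.prob_space by simp
    qed
  qed
  also have "\<dots> = (\<integral>\<omega>. exp (cpair (rsum \<omega> x) z) \<partial>\<Omega>)"
    by (simp add: sums_unique[OF exp_term_sums, symmetric])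
  finally show ?thesis .
qed

section \<open>Existence and support of the representing measure\<close>

definition rep_measure :: "'a \<Rightarrow> 'a measure" where
  "rep_measure x = distr \<Omega> borel (\<lambda>\<omega>. rsum \<omega> x)"

lemma rep_measure_prob: "rep_measure x \<in> borel_probs"
  unfolding borel_probs_def rep_measure_def using \<Omega>.prob_space_distr[OF rsum_measurable] by simp

lemma rep_measure_represents: "represents_kernel Rp k x (rep_measure x)"
  unfolding represents_kernel_def rep_measure_def
proof (intro allI conjI)
  fix z :: "'a \<times> 'a"
  have c: "continuous_on UNIV (\<lambda>y. exp (cpair y z))"
    by (intro continuous_on_exp cpair_continuous)
  have [measurable]: "(\<lambda>y. exp (cpair y z)) \<in> borel_measurable borel"
    using c by (rule borel_measurable_continuous_onI)
  show "integrable (distr \<Omega> borel (\<lambda>\<omega>. rsum \<omega> x)) (\<lambda>\<xi>. exp (cpair \<xi> z))"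
    using integrable_rsum[OF c] by (subst integrable_distr_eq) auto
  show "dunkl_kernel Rp k x z = (\<integral>\<xi>. exp (cpair \<xi> z) \<partial>distr \<Omega> borel (\<lambda>\<omega>. rsum \<omega> x))"
    by (subst integral_distr) (auto simp: dunkl_kernel_eq)
qed

section \<open>Geometry of the orbit hull\<close>

lemma orbit_hull_refl:
  assumes \<alpha>: "\<alpha> \<in> R" and y: "y \<in> orbit_hull R x"
  shows "root_refl \<alpha> y \<in> orbit_hull R x"
proof -
  note lin = bounded_linear.linear[OF root_refl_linear[of \<alpha>]]
  let ?O = "(\<lambda>w. w x) ` refl_group R"
  have "root_refl \<alpha> ` ?O \<subseteq> ?O"
  proof clarify
    fix w assume "w \<in> refl_group R"
    from imageI[OF refl_group_comp[OF this \<alpha>], of "\<lambda>w. w x"]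
    show "root_refl \<alpha> (w x) \<in> ?O" by simp
  qed
  then have "root_refl \<alpha> ` (convex hull ?O) \<subseteq> convex hull ?O"
    unfolding convex_hull_linear_image[OF lin] by (rule hull_mono)
  then have "root_refl \<alpha> ` closure (convex hull ?O) \<subseteq> closure (convex hull ?O)"
    using closure_linear_image_subset[OF lin] closure_mono by blast
  with y show ?thesis by (auto simp: orbit_hull_def)
qed

lemma orbit_hull_basic: "convex (orbit_hull R x)" "closed (orbit_hull R x)" "x \<in> orbit_hull R x"
proof -
  have "x \<in> (\<lambda>w. w x) ` refl_group R" using refl_group_id by (force intro: image_eqI[of _ _ id])
  then show "x \<in> orbit_hull R x"
    unfolding orbit_hull_def using closure_subset hull_subset by (metis subsetD)
qed (auto simp: orbit_hull_def convex_closure)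

text \<open>The point of the hull nearest to \<open>0\<close> is fixed by all reflections, so it is \<open>0\<close>.\<close>

lemma zero_in_orbit_hull: "0 \<in> orbit_hull R x"
proof -
  let ?C = "orbit_hull R x"
  define m where "m = closest_point ?C 0"
  have m: "m \<in> ?C" "\<forall>z\<in>?C. dist 0 m \<le> dist 0 z"
    unfolding m_def using closest_point_exists[OF orbit_hull_basic(2)] orbit_hull_basic(3) by blast+
  have "\<alpha> \<bullet> m = 0" if \<alpha>: "\<alpha> \<in> R" for \<alpha>
  proof -
    have "root_refl \<alpha> m = m"
      unfolding m_def
      using orbit_hull_refl[OF \<alpha> m(1)] m(2)
      by (intro closest_point_unique[OF orbit_hull_basic(1,2)]) (auto simp: m_def[symmetric])
    then have "(m \<bullet> coroot \<alpha>) *\<^sub>R \<alpha> = 0" by (simp add: root_refl_def)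
    then show ?thesis using root_nonzero(1)[OF \<alpha>] by (simp add: inner_coroot inner_commute)
  qed
  then have "span R \<subseteq> {v. v \<bullet> m = 0}"
    by (intro span_minimal subspaceI) (auto simp: inner_add_left)
  then have "m \<bullet> m = 0" unfolding span_R by blast
  then have "m = 0" by simp
  with m(1) show ?thesis by simp
qed

lemma rsum_in_orbit_hull: "rsum \<omega> x \<in> orbit_hull R x"
  using orbit_hull_basic zero_in_orbit_hull Rp_subset orbit_hull_refl
  by (intro rsum_in_convex) auto

lemma orbit_hull_subset_cball: "orbit_hull R x \<subseteq> cball 0 (norm x)"
proof -
  have "norm (w x) = norm x" if "w \<in> refl_group R" for w
    using that by induction auto
  then have "(\<lambda>w. w x) ` refl_group R \<subseteq> cball 0 (norm x)" by auto
  then show ?thesis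
    unfolding orbit_hull_def by (intro closure_minimal hull_minimal) auto
qed

section \<open>Exponential moments and the support of representing measures\<close>

lemma represents_kernel_exp:
  assumes \<mu>: "represents_kernel Rp k x \<mu>"
  shows "integrable \<mu> (\<lambda>\<xi>. exp (\<xi> \<bullet> y))"
    and "(\<integral>\<xi>. exp (\<xi> \<bullet> y) \<partial>\<mu>) = (\<integral>\<omega>. exp (rsum \<omega> x \<bullet> y) \<partial>\<Omega>)"
proof -
  \<comment> \<open>Support and uniqueness are both read off from the real arguments
    \<open>(y, 0)\<close>, where a representing measure has the moments of the random
    series.\<close>
  have real: "exp (cpair \<xi> (y, 0)) = of_real (exp (\<xi> \<bullet> y))" for \<xi>
    by (simp add: cpair_eq exp_of_real)
  have int: "integrable \<mu> (\<lambda>\<xi>. exp (cpair \<xi> (y, 0)))"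
    and eq: "dunkl_kernel Rp k x (y, 0) = (\<integral>\<xi>. exp (cpair \<xi> (y, 0)) \<partial>\<mu>)"
    using \<mu> by (auto simp: represents_kernel_def)
  from int show "integrable \<mu> (\<lambda>\<xi>. exp (\<xi> \<bullet> y))"
    unfolding real complex_of_real_integrable_eq .
  from eq show "(\<integral>\<xi>. exp (\<xi> \<bullet> y) \<partial>\<mu>) = (\<integral>\<omega>. exp (rsum \<omega> x \<bullet> y) \<partial>\<Omega>)"
    unfolding dunkl_kernel_eq real by (simp flip: of_real_exp)
qed

text \<open>Exponential Chebyshev inequality in the direction \<open>n y\<close>: the mass of the
  half-space is at most \<open>exp (n c') / exp (n c)\<close>, because the random series stays in
  the hull; now let n grow.\<close>

lemma halfspace_null:
  assumes \<mu>: "\<mu> \<in> borel_probs" "represents_kernel Rp k x \<mu>"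
    and c': "\<And>\<xi>. \<xi> \<in> orbit_hull R x \<Longrightarrow> \<xi> \<bullet> y \<le> c'" and "c' < c"
  shows "emeasure \<mu> {\<xi>. c \<le> \<xi> \<bullet> y} = 0"
proof -
  interpret \<mu>: prob_space \<mu> using \<mu>(1) by (simp add: borel_probs_def)
  let ?H = "{\<xi>. c \<le> \<xi> \<bullet> y}"
  have H: "?H \<in> sets \<mu>"
    using \<mu>(1) closed_Collect_le[of "\<lambda>_. c" "\<lambda>\<xi>. \<xi> \<bullet> y"] by (auto simp: borel_probs_def continuous_intros)
  have "measure \<mu> ?H \<le> exp (c' - c) ^ n" for n
  proof -
    let ?y = "real n *\<^sub>R y"
    have int: "integrable \<mu> (\<lambda>\<xi>. exp (real n * c) * indicator ?H \<xi>)"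
      using H by (intro integrable_mult_right integrable_real_indicator) (simp_all add: \<mu>.emeasure_eq_measure)
    have "exp (real n * c) * measure \<mu> ?H = (\<integral>\<xi>. exp (real n * c) * indicator ?H \<xi> \<partial>\<mu>)"
      using H by simp
    also have "\<dots> \<le> (\<integral>\<xi>. exp (\<xi> \<bullet> ?y) \<partial>\<mu>)"
      by (rule integral_mono[OF int represents_kernel_exp(1)[OF \<mu>(2)]])
         (auto split: split_indicator intro!: mult_left_mono)
    also have "\<dots> = (\<integral>\<omega>. exp (rsum \<omega> x \<bullet> ?y) \<partial>\<Omega>)"
      by (rule represents_kernel_exp(2)[OF \<mu>(2)])
    also have "\<dots> \<le> (\<integral>\<omega>. exp (real n * c') \<partial>\<Omega>)"
      using c'[OF rsum_in_orbit_hull]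
      by (intro integral_mono integrable_rsum[where f = "\<lambda>\<xi>. exp (\<xi> \<bullet> ?y)"] continuous_intros)
         (auto intro!: mult_left_mono)
    also have "\<dots> = exp (real n * c')" using \<Omega>.prob_space by simp
    finally have "measure \<mu> ?H \<le> exp (real n * c') / exp (real n * c)"
      by (simp add: field_simps)
    also have "\<dots> = exp (c' - c) ^ n"
      by (simp only: exp_diff power_divide exp_of_nat_mult)
    finally show ?thesis .
  qed
  moreover have "(\<lambda>n. exp (c' - c) ^ n) \<longlonglongrightarrow> 0"
    using \<open>c' < c\<close> by (intro LIMSEQ_realpow_zero) auto
  ultimately have "measure \<mu> ?H \<le> 0"
    by (intro LIMSEQ_le_const) auto
  then show ?thesis
    by (simp add: \<mu>.emeasure_eq_measure measure_le_0_iff)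
qed

lemma support_subset_orbit_hull:
  assumes \<mu>: "\<mu> \<in> borel_probs" "represents_kernel Rp k x \<mu>"
  shows "measure_support \<mu> \<subseteq> orbit_hull R x"
proof (rule ccontr)
  assume "\<not> measure_support \<mu> \<subseteq> orbit_hull R x"
  then obtain p where p: "p \<in> measure_support \<mu>" "p \<notin> orbit_hull R x" by blast
  obtain a b where ab: "a \<bullet> p < b" "\<forall>\<xi>\<in>orbit_hull R x. a \<bullet> \<xi> > b"
    using separating_hyperplane_closed_point[OF orbit_hull_basic(1,2) p(2)] by blast
  \<comment> \<open>Minus the midpoint of \<open>a \<bullet> p\<close> and b: after the sign change
    that turns the separating functional into an upper bound, the hull lies below
    \<open>- b < c\<close>, while p lies strictly above c.\<close>
  define c where "c = - ((a \<bullet> p + b) / 2)"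
  let ?U = "{\<xi>. c < \<xi> \<bullet> (- a)}"
  have "emeasure \<mu> {\<xi>. c \<le> \<xi> \<bullet> (- a)} = 0"
    using ab by (intro halfspace_null[OF \<mu>, of _ "- b"]) (force simp: c_def inner_commute)+
  moreover have "{\<xi>. c \<le> \<xi> \<bullet> (- a)} \<in> sets \<mu>"
    using \<mu>(1) closed_Collect_le[of "\<lambda>_. c" "\<lambda>\<xi>. \<xi> \<bullet> (- a)"]
    by (auto simp: borel_probs_def continuous_intros)
  moreover have "?U \<subseteq> {\<xi>. c \<le> \<xi> \<bullet> (- a)}" by auto
  ultimately have "emeasure \<mu> ?U \<le> 0"
    using emeasure_mono by metis
  moreover have "open ?U" by (intro open_Collect_less continuous_intros)
  moreover have "p \<in> ?U" using ab(1) by (simp add: c_def inner_commute field_simps)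
  ultimately show False using p(1) by (auto simp: measure_support_def)
qed

text \<open>Provides the compact set for Stone-Weierstrass. A box is cut out by finitely many
  half-spaces, and the added 1 leaves the strict gap that \<open>halfspace_null\<close>
  requires.\<close>

lemma AE_in_cbox:
  assumes \<mu>: "\<mu> \<in> borel_probs" "represents_kernel Rp k x \<mu>"
  shows "AE \<xi> in \<mu>. \<xi> \<in> cbox (- (norm x + 1) *\<^sub>R One) ((norm x + 1) *\<^sub>R One)"
proof -
  let ?r = "norm x + 1"
  have half: "AE \<xi> in \<mu>. \<xi> \<bullet> y < ?r" if y: "norm y = 1" for y
  proof (rule AE_I)
    show "{\<xi> \<in> space \<mu>. \<not> \<xi> \<bullet> y < ?r} \<subseteq> {\<xi>. ?r \<le> \<xi> \<bullet> y}" by auto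
    show "emeasure \<mu> {\<xi>. ?r \<le> \<xi> \<bullet> y} = 0"
    proof (rule halfspace_null[OF \<mu>])
      fix \<xi> assume "\<xi> \<in> orbit_hull R x"
      then have "norm \<xi> \<le> norm x" using orbit_hull_subset_cball[of x] by auto
      then show "\<xi> \<bullet> y \<le> norm x" using norm_cauchy_schwarz[of \<xi> y] y by simp
    qed simp
    show "{\<xi>. ?r \<le> \<xi> \<bullet> y} \<in> sets \<mu>"
      using \<mu>(1) closed_Collect_le[of "\<lambda>_. ?r" "\<lambda>\<xi>. \<xi> \<bullet> y"]
      by (auto simp: borel_probs_def continuous_intros)
  qed
  have "AE \<xi> in \<mu>. \<forall>b\<in>Basis. \<xi> \<bullet> b < ?r \<and> \<xi> \<bullet> (- b) < ?r"
    by (intro AE_finite_allI finite_Basis AE_conjI half) auto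
  then show ?thesis
    by eventually_elim (force simp: mem_box)
qed

end

section \<open>Uniqueness of the representing measure\<close>

text \<open>The span of the real exponentials, an algebra because exponents add under
  multiplication.\<close>

inductive_set exp_sums :: "('a::real_inner \<Rightarrow> real) set" where
  exp_sums_exp: "(\<lambda>\<xi>. exp (\<xi> \<bullet> y)) \<in> exp_sums"
| exp_sums_cmult: "g \<in> exp_sums \<Longrightarrow> (\<lambda>\<xi>. c * g \<xi>) \<in> exp_sums"
| exp_sums_add: "g \<in> exp_sums \<Longrightarrow> h \<in> exp_sums \<Longrightarrow> (\<lambda>\<xi>. g \<xi> + h \<xi>) \<in> exp_sums"

lemma exp_sums_mult:
  assumes "g \<in> exp_sums" "h \<in> exp_sums"
  shows "(\<lambda>\<xi>. g \<xi> * h \<xi>) \<in> exp_sums"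
  using assms(1)
proof (induction rule: exp_sums.induct)
  case (exp_sums_exp y)
  from assms(2) show ?case
  proof (induction rule: exp_sums.induct)
    case (exp_sums_exp y')
    show ?case
      using exp_sums.exp_sums_exp[of "y + y'"] by (simp add: exp_add inner_add_right)
  next
    case (exp_sums_cmult g c)
    from exp_sums.exp_sums_cmult[OF this(2), of c] show ?case by (simp add: mult.left_commute)
  next
    case (exp_sums_add g h)
    from exp_sums.exp_sums_add[OF this(3,4)] show ?case by (simp add: distrib_left)
  qed
next
  case (exp_sums_cmult g c)
  from exp_sums.exp_sums_cmult[OF this(2), of c] show ?case by (simp add: mult.assoc)
next
  case (exp_sums_add g h)
  from exp_sums.exp_sums_add[OF this(3,4)] show ?case by (simp add: distrib_right)
qed

lemma exp_sums_dense:
  fixes f :: "'a::real_inner \<Rightarrow> real"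
  assumes "compact S" "continuous_on S f" "e > 0"
  shows "\<exists>g\<in>exp_sums. \<forall>\<xi>\<in>S. \<bar>f \<xi> - g \<xi>\<bar> < e"
proof -
  interpret function_ring_on exp_sums S
  proof
    show "compact S" by fact
    show "continuous_on S g" if "g \<in> exp_sums" for g
      using that by (induction rule: exp_sums.induct) (auto intro!: continuous_intros)
    show "(\<lambda>_. c) \<in> exp_sums" for c :: real
      using exp_sums_cmult[OF exp_sums_exp[of 0], of c] by simp
    show "\<exists>g\<in>exp_sums. g \<xi> \<noteq> g \<eta>" if "\<xi> \<noteq> \<eta>" for \<xi> \<eta> :: 'a
    \<comment> \<open>With \<open>y = \<xi> - \<eta>\<close> the two exponents differ by the squared
      distance of the points.\<close>
    proof (rule bexI[OF _ exp_sums_exp[of "\<xi> - \<eta>"]])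
      have "\<xi> \<bullet> (\<xi> - \<eta>) - \<eta> \<bullet> (\<xi> - \<eta>) \<noteq> 0"
        using that by (simp flip: inner_diff_left)
      then show "exp (\<xi> \<bullet> (\<xi> - \<eta>)) \<noteq> exp (\<eta> \<bullet> (\<xi> - \<eta>))" by simp
    qed
  qed (auto intro: exp_sums_add exp_sums_mult)
  show ?thesis using Stone_Weierstrass_basic assms(2,3) by blast
qed

text \<open>Equality of integrals passes from \<open>exp_sums\<close> to continuous functions by
  uniform approximation on S, which carries both measures, then to closed sets by continuous
  approximation of indicators; these form an intersection-stable generator of the Borel
  sets.\<close>

lemma prob_measures_eq_if_exp_integrals_eq:
  fixes \<mu> \<nu> :: "'a::euclidean_space measure"
  assumes "prob_space \<mu>" "prob_space \<nu>" and sets: "sets \<mu> = sets borel" "sets \<nu> = sets borel"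
    and S: "compact S" and AE: "AE \<xi> in \<mu>. \<xi> \<in> S" "AE \<xi> in \<nu>. \<xi> \<in> S"
    and eq: "\<And>y. (\<integral>\<xi>. exp (\<xi> \<bullet> y) \<partial>\<mu>) = (\<integral>\<xi>. exp (\<xi> \<bullet> y) \<partial>\<nu>)"
  shows "\<mu> = \<nu>"
proof -
  interpret \<mu>: prob_space \<mu> by fact
  interpret \<nu>: prob_space \<nu> by fact
  note [measurable_cong] = sets
  have space: "space \<mu> = UNIV" "space \<nu> = UNIV"
    using sets_eq_imp_space_eq[OF sets(1)] sets_eq_imp_space_eq[OF sets(2)] by auto
  have bounded: "\<exists>B. \<forall>\<xi>\<in>S. norm (f \<xi>) \<le> B" if "continuous_on UNIV f" for f :: "'a \<Rightarrow> real"
    using compact_imp_bounded[OF compact_continuous_image[OF continuous_on_subset[OF that subset_UNIV] S]]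
    by (auto simp: bounded_iff)
  have int: "integrable \<mu> f" "integrable \<nu> f" if f: "continuous_on UNIV f" for f :: "'a \<Rightarrow> real"
  proof -
    have [measurable]: "f \<in> borel_measurable borel" using f by (rule borel_measurable_continuous_onI)
    obtain B where B: "\<forall>\<xi>\<in>S. norm (f \<xi>) \<le> B" using bounded[OF f] by blast
    show "integrable \<mu> f" using AE(1) B by (intro \<mu>.integrable_const_bound[of _ B]) auto
    show "integrable \<nu> f" using AE(2) B by (intro \<nu>.integrable_const_bound[of _ B]) auto
  qed
  have exp_sums: "continuous_on UNIV g \<and> (\<integral>\<xi>. g \<xi> \<partial>\<mu>) = (\<integral>\<xi>. g \<xi> \<partial>\<nu>)" if "g \<in> exp_sums" for g
    using that
  proof (induction rule: exp_sums.induct)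
    case (exp_sums_add g h)
    then show ?case by (auto simp: int intro: continuous_on_add)
  qed (auto intro!: continuous_intros simp: eq)
  have cont: "(\<integral>\<xi>. f \<xi> \<partial>\<mu>) = (\<integral>\<xi>. f \<xi> \<partial>\<nu>)" if f: "continuous_on UNIV f" for f :: "'a \<Rightarrow> real"
  proof (rule ccontr)
    assume neq: "(\<integral>\<xi>. f \<xi> \<partial>\<mu>) \<noteq> (\<integral>\<xi>. f \<xi> \<partial>\<nu>)"
    \<comment> \<open>Replacing f by g changes each integral by at most e, hence the difference by
      at most \<open>2 * e\<close>; it equals \<open>3 * e\<close>.\<close>
    define e where "e = \<bar>(\<integral>\<xi>. f \<xi> \<partial>\<mu>) - (\<integral>\<xi>. f \<xi> \<partial>\<nu>)\<bar> / 3"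
    have "e > 0" using neq by (simp add: e_def)
    then obtain g where g: "g \<in> exp_sums" "\<forall>\<xi>\<in>S. \<bar>f \<xi> - g \<xi>\<bar> < e"
      using exp_sums_dense[OF S continuous_on_subset[OF f subset_UNIV]] by blast
    have gc: "continuous_on UNIV g" and geq: "(\<integral>\<xi>. g \<xi> \<partial>\<mu>) = (\<integral>\<xi>. g \<xi> \<partial>\<nu>)"
      using exp_sums[OF g(1)] by auto
    have fgc: "continuous_on UNIV (\<lambda>\<xi>. f \<xi> - g \<xi>)" using f gc by (rule continuous_on_diff)
    have "\<bar>\<integral>\<xi>. f \<xi> - g \<xi> \<partial>\<mu>\<bar> \<le> (\<integral>\<xi>. e \<partial>\<mu>)"
      using AE(1) g(2) integrable_abs[OF int(1)[OF fgc]]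
      by (intro order_trans[OF integral_abs_bound] integral_mono_AE) (auto intro: less_imp_le)
    moreover have "\<bar>\<integral>\<xi>. f \<xi> - g \<xi> \<partial>\<nu>\<bar> \<le> (\<integral>\<xi>. e \<partial>\<nu>)"
      using AE(2) g(2) integrable_abs[OF int(2)[OF fgc]]
      by (intro order_trans[OF integral_abs_bound] integral_mono_AE) (auto intro: less_imp_le)
    ultimately have "\<bar>(\<integral>\<xi>. f \<xi> \<partial>\<mu>) - (\<integral>\<xi>. f \<xi> \<partial>\<nu>)\<bar> \<le> 2 * e"
      using geq \<mu>.prob_space \<nu>.prob_space by (simp add: int[OF f] int[OF gc])
    with \<open>e > 0\<close> show False by (simp add: e_def)
  qed
  have closed_eq: "measure \<mu> A = measure \<nu> A" if A: "closed A" for A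
  \<comment> \<open>The empty set is treated separately because \<open>infdist\<close> to it is 0 by
    convention.\<close>
  proof (cases "A = {}")
    case False
    \<comment> \<open>These functions are 1 on A and, A being closed, eventually 0 at each point
      outside.\<close>
    define f where "f n \<xi> = max 0 (1 - real n * infdist \<xi> A)" for n \<xi>
    have fc: "continuous_on UNIV (f n)" for n
      unfolding f_def by (intro continuous_intros)
    have [measurable]: "f n \<in> borel_measurable borel" for n
      by (rule borel_measurable_continuous_onI[OF fc])
    have [measurable]: "A \<in> sets borel" using A by simp
    have lim: "(\<lambda>n. f n \<xi>) \<longlonglongrightarrow> indicator A \<xi>" for \<xi>
    proof (cases "\<xi> \<in> A")
      case True
      then show ?thesis by (simp add: f_def)
    next
      case xi: False
      then have d: "infdist \<xi> A > 0"
        using in_closed_iff_infdist_zero[OF A False] infdist_nonneg[of \<xi> A] by (metis less_eq_real_def)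
      obtain n0 :: nat where n0: "1 / infdist \<xi> A < real n0" using reals_Archimedean2 by blast
      have "f n \<xi> = 0" if "n \<ge> n0" for n
      proof -
        have "1 / infdist \<xi> A \<le> real n" using n0 that by linarith
        then show ?thesis using d by (simp add: f_def divide_simps mult.commute)
      qed
      then have "eventually (\<lambda>n. f n \<xi> = 0) sequentially"
        by (auto simp: eventually_sequentially)
      then show ?thesis using xi by (simp add: tendsto_eventually)
    qed
    have f_bound: "\<bar>f n \<xi>\<bar> \<le> 1" for n \<xi>
      by (simp add: f_def infdist_nonneg)
    have "(\<lambda>n. \<integral>\<xi>. f n \<xi> \<partial>\<mu>) \<longlonglongrightarrow> (\<integral>\<xi>. indicator A \<xi> \<partial>\<mu>)"
      by (rule integral_dominated_convergence[where w = "\<lambda>_. 1"]) (auto simp: lim f_bound)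
    moreover have "(\<lambda>n. \<integral>\<xi>. f n \<xi> \<partial>\<nu>) \<longlonglongrightarrow> (\<integral>\<xi>. indicator A \<xi> \<partial>\<nu>)"
      by (rule integral_dominated_convergence[where w = "\<lambda>_. 1"]) (auto simp: lim f_bound)
    ultimately have "(\<integral>\<xi>. indicator A \<xi> \<partial>\<mu>) = (\<integral>\<xi>. indicator A \<xi> \<partial>\<nu> :: real)"
      unfolding cont[OF fc] by (rule LIMSEQ_unique)
    then show ?thesis by (simp add: space)
  qed simp
  show ?thesis
  proof (rule measure_eqI_generator_eq[where E = "Collect closed" and \<Omega> = UNIV and A = "\<lambda>_. UNIV"])
    show "Int_stable (Collect closed :: 'a set set)" by (auto simp: Int_stable_def)
    show "emeasure \<mu> X = emeasure \<nu> X" if "X \<in> Collect closed" for X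
      using closed_eq that by (simp add: \<mu>.emeasure_eq_measure \<nu>.emeasure_eq_measure)
  qed (auto simp: sets borel_eq_closed \<mu>.emeasure_eq_measure)
qed

context dunkl
begin

lemma representing_measure_unique:
  assumes \<mu>: "\<mu> \<in> borel_probs" "represents_kernel Rp k x \<mu>"
    and \<nu>: "\<nu> \<in> borel_probs" "represents_kernel Rp k x \<nu>"
  shows "\<mu> = \<nu>"
  using \<mu>(1) \<nu>(1) represents_kernel_exp(2)[OF \<mu>(2)] represents_kernel_exp(2)[OF \<nu>(2)]
  by (intro prob_measures_eq_if_exp_integrals_eq[OF _ _ _ _ compact_cbox AE_in_cbox[OF \<mu>] AE_in_cbox[OF \<nu>]])
     (auto simp: borel_probs_def)

end

theorem proposition3p1:
  fixes R Rp :: "'a::euclidean_space set" and k :: "'a \<Rightarrow> real"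
  assumes "root_system R" and "crystallographic R" and "reduced_roots R" and "indecomposable R"
    and "positive_subsystem R Rp"
    and "nonneg_multiplicity R k"
  shows "\<forall>x. (\<exists>!\<mu>. \<mu> \<in> borel_probs \<and> represents_kernel Rp k x \<mu>) \<and>
             (\<forall>\<mu>. \<mu> \<in> borel_probs \<and> represents_kernel Rp k x \<mu> \<longrightarrow>
                  measure_support \<mu> \<subseteq> orbit_hull R x)"
proof -
  interpret dunkl R Rp k
    using assms by unfold_locales
  show ?thesis
    using rep_measure_prob rep_measure_represents representing_measure_unique support_subset_orbit_hull
    by blast
qed

end
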